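(* Let $\mathbf y\in\mathbb R^n$ and let $X=(\mathbf x_1,\dots,\mathbf x_m)$ be an $n\times m$ real matrix with linearly independent columns, standardized so that $\sum_i y_i=0$, $\sum_i x_{ij}=0$, $\sum_i x_{ij}^2=1$ for all $j$. Then, under the Stagewise modification, the LARS algorithm yields all Stagewise solutions: the path of coefficient vectors traced out by the Stagewise-modified LARS algorithm, suitably parametrized, is an idealized Stagewise track, and it is the only idealized Stagewise track (both notions are defined in the context).
   Context: For an estimate $\widehat{\boldsymbol\beta}\in\mathbb R^m$, with $\widehat{\boldsymbol\mu}=X\widehat{\boldsymbol\beta}$, let $\hat{\mathbf c}=X'(\mathbf y-\widehat{\boldsymbol\mu})$, $\widehat C=\max_j|\hat c_j|$, $\mathcal A=\{j:|\hat c_j|=\widehat C\}$ (the maximal set), and $s_j=\operatorname{sign}(\hat c_j)$. For nonempty $\mathcal B\subseteq\mathcal A$ put $X_{\mathcal B}=(\cdots s_j\mathbf x_j\cdots)_{j\in\mathcal B}$, $\mathcal G_{\mathcal B}=X_{\mathcal B}'X_{\mathcal B}$, $A_{\mathcal B}=(\mathbf 1_{\mathcal B}'\mathcal G_{\mathcal B}^{-1}\mathbf 1_{\mathcal B})^{-1/2}$, $\mathbf u_{\mathcal B}=A_{\mathcal B}X_{\mathcal B}\mathcal G_{\mathcal B}^{-1}\mathbf 1_{\mathcal B}$ (the equiangular unit vector) and $\mathbf v_{\mathcal B}=A_{\mathcal B}\mathbf u_{\mathcal B}$, with $\mathbf 1_{\mathcal B}$ the vector of ones. Let $\mathcal C_{\mathcal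 A}=\{\sum_{j\in\mathcal A}s_j\mathbf x_jP_j: P_j\ge0\}$ be the convex cone generated by the columns of $X_{\mathcal A}$. Stagewise-modified LARS algorithm. Start at $\widehat{\boldsymbol\mu}=0$. While $\widehat C>0$: with $\mathcal A$ the current maximal set, let $\sum_{j\in\mathcal A}s_j\mathbf x_j\hat P_j$, $\hat P_j\ge0$, be the nearest point to $\mathbf u_{\mathcal A}$ in $\mathcal C_{\mathcal A}$, and let $\widehat{\mathcal B}=\{j\in\mathcal A:\hat P_j>0\}$ (then $\mathbf u_{\widehat{\mathcal B}}$ is the unit vector along this projection). With $\mathbf a=X'\mathbf u_{\widehat{\mathcal B}}$ let $$\hat\gamma=\min_{j\in\widehat{\mathcal B}^c}{}^{+}\left\{\frac{\widehat C-\hat c_j}{A_{\widehat{\mathcal B}}-a_j},\ \frac{\widehat C+\hat c_j}{A_{\widehat{\mathcal B}}+a_j}\right\}$$ (only quotients that are defined and positive are considered; $\hat\gamma=\widehat C/A_{\widehat{\mathcal B}}$ if $\widehat{\mathcal B}=\{1,\dots,m\}$). Move along the segment $\widehat{\boldsymbol\mu}+\gamma\mathbf u_{\widehat{\mathcal B}}$, $0\le\gamma\le\hat\gamma$, replace $\widehat{\boldsymbol\mu}$ by its endpoint, recompute the maximal set, and repeat. Stop when $\widehat C=0$ (i.e. $\widehat{\boldsymbol\mu}$ is the full least squares fit). The coefficient path $\widehat{\boldsymbol\beta}$ is determined by $X\widehat{\boldsymbol\beta}=\widehat{\boldsymbol\mu}$. Idealized Stagewise procedure. The Stagewise procedure with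 step size $\varepsilon>0$ starts at $\widehat{\boldsymbol\mu}=0$ and repeatedly takes $\hat j=\arg\max_j|\hat c_j|$ and replaces $\widehat{\boldsymbol\mu}$ by $\widehat{\boldsymbol\mu}+\varepsilon\operatorname{sign}(\hat c_{\hat j})\mathbf x_{\hat j}$. Its idealization as $\varepsilon\to0$ is formalized as follows. An idealized Stagewise track is a continuous, everywhere right differentiable family $\widehat{\boldsymbol\beta}(z)$, $z\in[0,z_{\max}]$ (right differentiable on $[0,z_{\max})$), with $\widehat{\boldsymbol\beta}(0)=0$, $\widehat{\boldsymbol\beta}(z_{\max})$ equal to the full ordinary least squares coefficient vector, $\widehat C>0$ for $z<z_{\max}$, and such that at each $z<z_{\max}$ the right derivative $\mathbf v$ of $X\widehat{\boldsymbol\beta}(z)$ satisfies, with $\mathcal A$ and $s_j$ the maximal set and signs at $\widehat{\boldsymbol\beta}(z)$, the following constraints for some nonempty $\mathcal B\subseteq\mathcal A$: (I) $\mathbf v\in\mathcal S^+_{\mathcal A}=\{\sum_{j\in\mathcal A}s_j\mathbf x_jP_j:P_j\ge0,\ \sum_{j\in\mathcal A}P_j=1\}$; (II) $\mathbf v=\mathbf v_{\mathcal B}$; (III) $s_j\mathbf x_j'\mathbf v_{\mathcal B}\ge A_{\mathcal B}^2$ for all $j\in\mathcal A\setminus\mathcal B$. (The parameter $z$ represents total Stagewise step length.) *)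

theory Defs
  imports "HOL-Analysis.Analysis"
begin

text \<open>
  The design matrix is \<open>X :: real^'m^'n\<close>: rows are indexed by \<open>'n\<close> and the covariates are
  \<open>column j X\<close> for \<open>j :: 'm\<close>. Fits are vectors \<open>\<mu> :: real^'n\<close>, coefficient vectors have type
  \<open>real^'m\<close>.
\<close>

definition corr :: "real^'m^'n \<Rightarrow> real^'n \<Rightarrow> real^'n \<Rightarrow> real^'m" where
  "corr X y \<mu> = transpose X *v (y - \<mu>)"

definition max_corr :: "real^'m^'n \<Rightarrow> real^'n \<Rightarrow> real^'n \<Rightarrow> real" where
  "max_corr X y \<mu> = Max (range (\<lambda>j. \<bar>corr X y \<mu> $ j\<bar>))"

definition max_set :: "real^'m^'n \<Rightarrow> real^'n \<Rightarrow> real^'n \<Rightarrow> 'm set" where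
  "max_set X y \<mu> = {j. \<bar>corr X y \<mu> $ j\<bar> = max_corr X y \<mu>}"

definition corr_sign :: "real^'m^'n \<Rightarrow> real^'n \<Rightarrow> real^'n \<Rightarrow> 'm \<Rightarrow> real" where
  "corr_sign X y \<mu> j = sgn (corr X y \<mu> $ j)"

definition signed_col :: "real^'m^'n \<Rightarrow> ('m \<Rightarrow> real) \<Rightarrow> 'm \<Rightarrow> real^'n" where
  "signed_col X s j = s j *\<^sub>R column j X"

text \<open>
  The index set \<open>B\<close> of \<open>X\<^sub>B\<close> and its Gram matrix varies, so \<open>B \<times> B\<close> matrices are represented by
  functions \<open>'m \<Rightarrow> 'm \<Rightarrow> real\<close> of which only the entries with both indices in \<open>B\<close> are used.
  \<open>inverse_on B M\<close> plays the role of \<open>matrix_inv\<close>; it is meaningful only if \<open>M\<close> is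
  invertible on \<open>B\<close>.
\<close>

definition is_inverse_on :: "'m set \<Rightarrow> ('m \<Rightarrow> 'm \<Rightarrow> real) \<Rightarrow> ('m \<Rightarrow> 'm \<Rightarrow> real) \<Rightarrow> bool" where
  "is_inverse_on B M N \<longleftrightarrow>
     (\<forall>i\<in>B. \<forall>j\<in>B. (\<Sum>k\<in>B. M i k * N k j) = (if i = j then 1 else 0) \<and>
                   (\<Sum>k\<in>B. N i k * M k j) = (if i = j then 1 else 0))"

definition inverse_on :: "'m set \<Rightarrow> ('m \<Rightarrow> 'm \<Rightarrow> real) \<Rightarrow> 'm \<Rightarrow> 'm \<Rightarrow> real" where
  "inverse_on B M = (SOME N. is_inverse_on B M N)"

definition gram :: "real^'m^'n \<Rightarrow> ('m \<Rightarrow> real) \<Rightarrow> 'm \<Rightarrow> 'm \<Rightarrow> real" where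
  "gram X s i j = signed_col X s i \<bullet> signed_col X s j"

text \<open>
  \<open>equi_const\<close>, \<open>equi_vec\<close> and \<open>equi_vel\<close> are \<open>A\<^sub>B\<close>, the equiangular unit vector \<open>u\<^sub>B\<close> and
  \<open>v\<^sub>B = A\<^sub>B u\<^sub>B\<close>, for the signs \<open>s\<close>.
\<close>

definition equi_const :: "real^'m^'n \<Rightarrow> ('m \<Rightarrow> real) \<Rightarrow> 'm set \<Rightarrow> real" where
  "equi_const X s B = (\<Sum>i\<in>B. \<Sum>j\<in>B. inverse_on B (gram X s) i j) powr (- 1 / 2)"

definition equi_vec :: "real^'m^'n \<Rightarrow> ('m \<Rightarrow> real) \<Rightarrow> 'm set \<Rightarrow> real^'n" where
  "equi_vec X s B = equi_const X s B *\<^sub>R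
     (\<Sum>i\<in>B. (\<Sum>j\<in>B. inverse_on B (gram X s) i j) *\<^sub>R signed_col X s i)"

definition equi_vel :: "real^'m^'n \<Rightarrow> ('m \<Rightarrow> real) \<Rightarrow> 'm set \<Rightarrow> real^'n" where
  "equi_vel X s B = equi_const X s B *\<^sub>R equi_vec X s B"

definition signed_cone :: "real^'m^'n \<Rightarrow> ('m \<Rightarrow> real) \<Rightarrow> 'm set \<Rightarrow> (real^'n) set" where
  "signed_cone X s A = {\<Sum>j\<in>A. P j *\<^sub>R signed_col X s j | P. \<forall>j\<in>A. 0 \<le> P j}"

definition signed_simplex :: "real^'m^'n \<Rightarrow> ('m \<Rightarrow> real) \<Rightarrow> 'm set \<Rightarrow> (real^'n) set" where
  "signed_simplex X s A =
     {\<Sum>j\<in>A. P j *\<^sub>R signed_col X s j | P. (\<forall>j\<in>A. 0 \<le> P j) \<and> (\<Sum>j\<in>A. P j) = 1}"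

definition is_ols :: "real^'m^'n \<Rightarrow> real^'n \<Rightarrow> real^'m \<Rightarrow> bool" where
  "is_ols X y b \<longleftrightarrow> (\<forall>b'. (norm (y - X *v b))\<^sup>2 \<le> (norm (y - X *v b'))\<^sup>2)"


section \<open>The Stagewise-modified LARS algorithm\<close>

definition proj_coeffs :: "real^'m^'n \<Rightarrow> ('m \<Rightarrow> real) \<Rightarrow> 'm set \<Rightarrow> 'm \<Rightarrow> real" where
  "proj_coeffs X s A = (SOME P. (\<forall>j\<in>A. 0 \<le> P j) \<and>
     (\<Sum>j\<in>A. P j *\<^sub>R signed_col X s j) = closest_point (signed_cone X s A) (equi_vec X s A))"

definition step_set :: "real^'m^'n \<Rightarrow> real^'n \<Rightarrow> real^'n \<Rightarrow> 'm set" where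
  "step_set X y \<mu> =
     {j \<in> max_set X y \<mu>. 0 < proj_coeffs X (corr_sign X y \<mu>) (max_set X y \<mu>) j}"

definition step_dir :: "real^'m^'n \<Rightarrow> real^'n \<Rightarrow> real^'n \<Rightarrow> real^'n" where
  "step_dir X y \<mu> = equi_vec X (corr_sign X y \<mu>) (step_set X y \<mu>)"

definition step_length :: "real^'m^'n \<Rightarrow> real^'n \<Rightarrow> real^'n \<Rightarrow> real" where
  "step_length X y \<mu> =
     (let B = step_set X y \<mu>;
          c = corr X y \<mu>;
          C = max_corr X y \<mu>;
          K = equi_const X (corr_sign X y \<mu>) B;
          a = transpose X *v step_dir X y \<mu>
      in if B = UNIV then C / K
         else Min ({q. 0 < q \<and> (\<exists>j. j \<notin> B \<and> K - a $ j \<noteq> 0 \<and> q = (C - c $ j) / (K - a $ j))} \<union>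
                   {q. 0 < q \<and> (\<exists>j. j \<notin> B \<and> K + a $ j \<noteq> 0 \<and> q = (C + c $ j) / (K + a $ j))}))"

text \<open>The fit after \<open>k\<close> steps; it is only meaningful as long as the algorithm has not stopped.\<close>

primrec lars_fit :: "real^'m^'n \<Rightarrow> real^'n \<Rightarrow> nat \<Rightarrow> real^'n" where
  "lars_fit X y 0 = 0"
| "lars_fit X y (Suc k) =
     lars_fit X y k + step_length X y (lars_fit X y k) *\<^sub>R step_dir X y (lars_fit X y k)"

definition lars_stops_at :: "real^'m^'n \<Rightarrow> real^'n \<Rightarrow> nat \<Rightarrow> bool" where
  "lars_stops_at X y K \<longleftrightarrow>
     max_corr X y (lars_fit X y K) = 0 \<and> (\<forall>k<K. 0 < max_corr X y (lars_fit X y k))"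

definition lars_time :: "real^'m^'n \<Rightarrow> real^'n \<Rightarrow> nat \<Rightarrow> real" where
  "lars_time X y k = (\<Sum>i<k. step_length X y (lars_fit X y i))"

text \<open>
  The algorithm stops after finitely many steps, and \<open>\<alpha>\<close> on \<open>{0..L}\<close> is the coefficient path it
  traces out, the segments of all steps being joined and each parametrized by its \<open>\<gamma>\<close>.
  The clause at \<open>0\<close> only matters if the algorithm stops immediately.
\<close>

definition lars_path :: "real^'m^'n \<Rightarrow> real^'n \<Rightarrow> real \<Rightarrow> (real \<Rightarrow> real^'m) \<Rightarrow> bool" where
  "lars_path X y L \<alpha> \<longleftrightarrow>
     (\<exists>K. lars_stops_at X y K \<and> L = lars_time X y K \<and> X *v \<alpha> 0 = 0 \<and>
        (\<forall>k<K. \<forall>\<gamma>\<in>{0..step_length X y (lars_fit X y k)}.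
           X *v \<alpha> (lars_time X y k + \<gamma>) =
             lars_fit X y k + \<gamma> *\<^sub>R step_dir X y (lars_fit X y k)))"

definition reparametrizes ::
  "real \<Rightarrow> (real \<Rightarrow> 'a) \<Rightarrow> real \<Rightarrow> (real \<Rightarrow> 'a) \<Rightarrow> bool" where
  "reparametrizes T \<beta> L \<alpha> \<longleftrightarrow>
     (\<exists>h. continuous_on {0..T} h \<and> strict_mono_on {0..T} h \<and> h ` {0..T} = {0..L} \<and>
          (\<forall>z\<in>{0..T}. \<beta> z = \<alpha> (h z)))"


section \<open>Idealized Stagewise tracks\<close>

definition stagewise_velocity ::
  "real^'m^'n \<Rightarrow> real^'n \<Rightarrow> real^'n \<Rightarrow> real^'n \<Rightarrow> bool" where
  "stagewise_velocity X y \<mu> v \<longleftrightarrow>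
     (let A = max_set X y \<mu>; s = corr_sign X y \<mu>
      in \<exists>B. B \<noteq> {} \<and> B \<subseteq> A \<and>
             v \<in> signed_simplex X s A \<and>
             v = equi_vel X s B \<and>
             (\<forall>j\<in>A - B. s j * (column j X \<bullet> equi_vel X s B) \<ge> (equi_const X s B)\<^sup>2))"

text \<open>Only the values of \<open>\<beta>\<close> on \<open>{0..T}\<close> matter.\<close>

definition stagewise_track :: "real^'m^'n \<Rightarrow> real^'n \<Rightarrow> real \<Rightarrow> (real \<Rightarrow> real^'m) \<Rightarrow> bool" where
  "stagewise_track X y T \<beta> \<longleftrightarrow>
     0 \<le> T \<and>
     continuous_on {0..T} \<beta> \<and>
     \<beta> 0 = 0 \<and>
     is_ols X y (\<beta> T) \<and>
     (\<forall>z\<in>{0..<T}.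
        0 < max_corr X y (X *v \<beta> z) \<and>
        (\<exists>d. (\<beta> has_vector_derivative d) (at_right z)) \<and>
        (\<exists>v. ((\<lambda>t. X *v \<beta> t) has_vector_derivative v) (at_right z) \<and>
             stagewise_velocity X y (X *v \<beta> z) v))"

end

theory Submission imports Defs begin

text \<open>
  The maximal absolute correlation \<open>\<mu> \<mapsto> max_corr X y \<mu>\<close> is a convex function of the fit. Where it
  is positive, its subdifferential is the negative of the simplex of the signed columns in the
  maximal set. Constraints (I)--(III) say that \<open>v\<close> is the point of least norm of that simplex: by
  (II) and (III) every point of the simplex has inner product at least \<open>A\<^sub>B\<^sup>2 = |v|\<^sup>2\<close> with \<open>v\<close>. So an
  idealized Stagewise track is a curve of steepest descent (gradient flow) of a convex function, and
  this explains both halves of the theorem.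

  Uniqueness. The subdifferential of a convex function is monotone (\<open>simplex_monotone\<close>), so the
  squared distance between the fits of two tracks has nonpositive right derivative. It starts at
  \<open>0\<close>, hence stays \<open>0\<close> (\<open>stagewise_fits_agree\<close>). A track ends exactly when all correlations vanish,
  that is, at the least squares fit, so the durations agree as well. Linear independence of the
  columns carries this over from fits to coefficients.

  Existence. The optimality conditions for the projection of \<open>u\<^sub>A\<close> onto the cone show that the set
  chosen by the algorithm satisfies (I)--(III) at the start of its step (\<open>projection_face\<close>). Along
  the step, the correlations of the chosen columns decrease together; a maximal column that was not
  chosen either keeps up with them or drops out; and the quotients in the step length are the times
  at which one of the remaining columns, with one of the two signs, would overtake. So (I)--(III)
  hold with the same set at every point before the end of the step (\<open>stagewise_velocity_moved\<close>), and
  concatenating the segments, each run through at speed \<open>A\<^sub>B\<close>, gives a track.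

  Termination. The column that joins at the end of a step makes an angle with the old direction that
  is too large for the old velocity to remain the point of least norm, so \<open>A\<^sub>B\<close> strictly decreases
  from step to step (\<open>equi_const_next_less\<close>). It takes only finitely many values, because it depends
  only on a sign vector and a set of indices.
\<close>

section \<open>Signed columns and Gram matrices\<close>

lemma inj_design:
  fixes X :: "real^'m^'n"
  assumes "\<And>b :: 'm \<Rightarrow> real. (\<Sum>j\<in>UNIV. b j *\<^sub>R column j X) = 0 \<Longrightarrow> (\<forall>j. b j = 0)"
  shows "inj ((*v) X)"
proof -
  have "x = 0" if "X *v x = 0" for x
    using assms[of "\<lambda>j. x $ j"] that
    by (simp add: matrix_mult_sum scalar_mult_eq_scaleR vec_eq_iff)
  then show ?thesis
    by (simp add: linear_injective_0[OF matrix_vector_mul_linear])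
qed

lemma transpose_mult_component: "(transpose X *v w) $ j = column j X \<bullet> (w :: real^'n)"
  by (simp add: matrix_vector_mult_def transpose_def column_def inner_vec_def)

lemma corr_component: "corr X y \<mu> $ j = column j X \<bullet> (y - \<mu>)"
  unfolding corr_def by (rule transpose_mult_component)

lemma signed_comb_as_product:
  "(\<Sum>j\<in>B. P j *\<^sub>R signed_col X s j) = X *v (\<chi> j. if j \<in> B then P j * s j else 0)"
proof -
  have "X *v (\<chi> j. if j \<in> B then P j * s j else 0)
      = (\<Sum>j\<in>UNIV. if j \<in> B then (P j * s j) *\<^sub>R column j X else 0)"
    by (auto simp: matrix_mult_sum scalar_mult_eq_scaleR intro!: sum.cong)
  also have "\<dots> = (\<Sum>j\<in>B. (P j * s j) *\<^sub>R column j X)"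
    by (simp add: sum.If_cases)
  finally show ?thesis by (simp add: signed_col_def)
qed

lemma signed_comb_eq_0:
  assumes inj: "inj ((*v) X)" and s: "\<forall>j\<in>B. s j \<noteq> 0"
    and 0: "(\<Sum>j\<in>B. P j *\<^sub>R signed_col X s j) = 0" and "j \<in> B"
  shows "P j = 0"
proof -
  have "X *v (\<chi> j. if j \<in> B then P j * s j else 0) = X *v 0"
    using 0 by (simp add: signed_comb_as_product)
  then have "(\<chi> j. if j \<in> B then P j * s j else 0) = (0 :: real^_)"
    by (rule injD[OF inj])
  then have "(\<chi> j. if j \<in> B then P j * s j else 0) $ j = (0 :: real)"
    by simp
  then show ?thesis using s \<open>j \<in> B\<close> by auto
qed

text \<open>
  The Gram matrix on \<open>B\<close> is extended by the identity outside \<open>B\<close>. The extension is a square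
  matrix over the full index type, and its kernel is trivial since the Gram form is the squared norm
  of a combination of independent columns; the \<open>B\<close> block of its inverse is the inverse on \<open>B\<close>.
\<close>

lemma gram_invertible_on:
  fixes X :: "real^'m^'n"
  assumes inj: "inj ((*v) X)" and s: "\<forall>j\<in>B. s j \<noteq> 0"
  shows "is_inverse_on B (gram X s) (inverse_on B (gram X s))"
proof -
  define G :: "real^'m^'m" where
    "G = (\<chi> i j. if i \<in> B \<and> j \<in> B then gram X s i j else if i = j then 1 else 0)"
  have "x = 0" if Gx: "G *v x = 0" for x
  proof -
    let ?v = "\<Sum>j\<in>B. x $ j *\<^sub>R signed_col X s j"
    have out: "x $ i = 0" if "i \<notin> B" for i
    proof -
      have "0 = (\<Sum>j\<in>UNIV. G $ i $ j * x $ j)"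
        using Gx by (simp add: matrix_vector_mult_def vec_eq_iff)
      also have "\<dots> = (\<Sum>j\<in>UNIV. if i = j then x $ j else 0)"
        using that by (intro sum.cong) (auto simp: G_def)
      finally show ?thesis by simp
    qed
    have "signed_col X s i \<bullet> ?v = 0" if "i \<in> B" for i
    proof -
      have "0 = (\<Sum>j\<in>UNIV. G $ i $ j * x $ j)"
        using Gx by (simp add: matrix_vector_mult_def vec_eq_iff)
      also have "\<dots> = (\<Sum>j\<in>UNIV. if j \<in> B then gram X s i j * x $ j else 0)"
        using that by (intro sum.cong) (auto simp: G_def)
      also have "\<dots> = (\<Sum>j\<in>B. gram X s i j * x $ j)"
        by (simp add: sum.If_cases)
      finally show ?thesis
        by (simp add: inner_sum_right gram_def mult.commute)
    qed
    then have "?v \<bullet> ?v = 0"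
      by (simp only: inner_sum_left inner_scaleR_left) simp
    then have "?v = 0" by simp
    then have "x $ i = 0" if "i \<in> B" for i
      using signed_comb_eq_0[OF inj s] that by blast
    with out show "x = 0" by (auto simp: vec_eq_iff)
  qed
  then have "invertible G"
    by (simp add: invertible_left_inverse matrix_left_invertible_ker)
  then obtain N where N: "G ** N = mat 1" "N ** G = mat 1"
    by (auto simp: invertible_def)
  have "is_inverse_on B (gram X s) (\<lambda>i j. N $ i $ j)"
    unfolding is_inverse_on_def
  proof (intro ballI conjI)
    fix i j assume ij: "i \<in> B" "j \<in> B"
    have "(\<Sum>k\<in>UNIV. G $ i $ k * N $ k $ j) = (if i = j then 1 else 0)"
      using arg_cong[OF N(1), of "\<lambda>A. A $ i $ j"] by (simp add: matrix_matrix_mult_def mat_def)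
    moreover have "(\<Sum>k\<in>UNIV. G $ i $ k * N $ k $ j)
        = (\<Sum>k\<in>UNIV. if k \<in> B then gram X s i k * N $ k $ j else 0)"
      using ij by (intro sum.cong) (auto simp: G_def)
    ultimately show "(\<Sum>k\<in>B. gram X s i k * N $ k $ j) = (if i = j then 1 else 0)"
      by (simp add: sum.If_cases)
    have "(\<Sum>k\<in>UNIV. N $ i $ k * G $ k $ j) = (if i = j then 1 else 0)"
      using arg_cong[OF N(2), of "\<lambda>A. A $ i $ j"] by (simp add: matrix_matrix_mult_def mat_def)
    moreover have "(\<Sum>k\<in>UNIV. N $ i $ k * G $ k $ j)
        = (\<Sum>k\<in>UNIV. if k \<in> B then N $ i $ k * gram X s k j else 0)"
      using ij by (intro sum.cong) (auto simp: G_def)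
    ultimately show "(\<Sum>k\<in>B. N $ i $ k * gram X s k j) = (if i = j then 1 else 0)"
      by (simp add: sum.If_cases)
  qed
  then show ?thesis unfolding inverse_on_def by (rule someI[of "is_inverse_on B (gram X s)"])
qed

section \<open>Equiangular vectors\<close>

text \<open>
  With \<open>g = X\<^sub>B G\<^sub>B\<inverse> 1\<close> one has \<open>X\<^sub>B' g = 1\<close>, so \<open>|g|\<^sup>2\<close> is the sum \<open>S\<close> of the coefficients of \<open>g\<close>,
  which is the sum of the entries of \<open>G\<^sub>B\<inverse>\<close>. The equiangular vector is \<open>g / \<surd>S\<close>.
\<close>

lemma equi_vec_properties:
  assumes inj: "inj ((*v) X)" and s: "\<forall>j\<in>B. s j \<noteq> 0" and "B \<noteq> {}"
  shows equi_const_pos: "0 < equi_const X s B"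
    and equi_vec_angle: "\<And>j. j \<in> B \<Longrightarrow> signed_col X s j \<bullet> equi_vec X s B = equi_const X s B"
    and norm_equi_vec: "norm (equi_vec X s B) = 1"
proof -
  define N where "N = inverse_on B (gram X s)"
  define w where "w i = (\<Sum>j\<in>B. N i j)" for i
  define g where "g = (\<Sum>i\<in>B. w i *\<^sub>R signed_col X s i)"
  define S where "S = (\<Sum>i\<in>B. w i)"
  have inv: "is_inverse_on B (gram X s) N"
    unfolding N_def by (rule gram_invertible_on[OF inj s])
  have angle: "signed_col X s j \<bullet> g = 1" if "j \<in> B" for j
  proof -
    have "signed_col X s j \<bullet> g = (\<Sum>i\<in>B. gram X s j i * w i)"
      by (simp add: g_def inner_sum_right gram_def mult.commute)
    also have "\<dots> = (\<Sum>i\<in>B. \<Sum>k\<in>B. gram X s j i * N i k)"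
      by (simp add: w_def sum_distrib_left)
    also have "\<dots> = (\<Sum>k\<in>B. \<Sum>i\<in>B. gram X s j i * N i k)"
      by (rule sum.swap)
    also have "\<dots> = (\<Sum>k\<in>B. if j = k then 1 else 0)"
      using inv that by (simp add: is_inverse_on_def)
    finally show ?thesis using that by simp
  qed
  have "g \<bullet> g = (\<Sum>i\<in>B. w i * (signed_col X s i \<bullet> g))"
    by (subst (1) g_def) (simp add: inner_sum_left)
  then have gg: "g \<bullet> g = S" using angle by (simp add: S_def)
  have "g \<noteq> 0" using angle \<open>B \<noteq> {}\<close> by fastforce
  then have "0 < S" using gg inner_gt_zero_iff[of g] by simp
  have K: "equi_const X s B = 1 / sqrt S"
  proof -
    have "equi_const X s B = S powr (- (1 / 2))"
      by (simp add: equi_const_def S_def w_def N_def)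
    also have "\<dots> = 1 / sqrt S"
      using \<open>0 < S\<close> by (simp only: powr_minus powr_half_sqrt less_imp_le inverse_eq_divide)
    finally show ?thesis .
  qed
  have u: "equi_vec X s B = (1 / sqrt S) *\<^sub>R g"
    unfolding equi_vec_def K by (simp add: g_def w_def N_def)
  show "0 < equi_const X s B" using K \<open>0 < S\<close> by simp
  show "signed_col X s j \<bullet> equi_vec X s B = equi_const X s B" if "j \<in> B" for j
    using angle[OF that] by (simp add: K u)
  show "norm (equi_vec X s B) = 1"
    using gg \<open>0 < S\<close> by (simp add: u norm_eq_sqrt_inner)
qed

lemma equi_vec_comb:
  "\<exists>w. equi_vec X s B = (\<Sum>j\<in>B. w j *\<^sub>R signed_col X s j)"
  unfolding equi_vec_def by (auto simp: scaleR_sum_right)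

text \<open>
  The difference of two vectors of the span that make the same inner product with every signed
  column is orthogonal to the span in which it lies.
\<close>

lemma equiangular_unique:
  assumes inj: "inj ((*v) X)" and s: "\<forall>j\<in>B. s j \<noteq> 0" and "B \<noteq> {}"
    and p: "p = (\<Sum>j\<in>B. P j *\<^sub>R signed_col X s j)"
    and angle: "\<And>j. j \<in> B \<Longrightarrow> signed_col X s j \<bullet> p = \<kappa>"
  shows "p = (\<kappa> / equi_const X s B) *\<^sub>R equi_vec X s B"
proof -
  let ?K = "equi_const X s B" and ?u = "equi_vec X s B"
  note eq = equi_vec_properties[OF inj s \<open>B \<noteq> {}\<close>]
  obtain w where w: "?u = (\<Sum>j\<in>B. w j *\<^sub>R signed_col X s j)"
    using equi_vec_comb by blast
  define d where "d = p - (\<kappa> / ?K) *\<^sub>R ?u"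
  have d: "d = (\<Sum>j\<in>B. (P j - \<kappa> / ?K * w j) *\<^sub>R signed_col X s j)"
    unfolding d_def p by (simp add: w scaleR_sum_right sum_subtractf scaleR_diff_left)
  have orth: "signed_col X s j \<bullet> d = 0" if "j \<in> B" for j
    using angle[OF that] eq(1) eq(2)[OF that] by (simp add: d_def inner_diff_right)
  have "d \<bullet> d = (\<Sum>j\<in>B. (P j - \<kappa> / ?K * w j) * (signed_col X s j \<bullet> d))"
    by (subst (1) d) (simp add: inner_sum_left)
  then have "d \<bullet> d = 0" using orth by simp
  then show ?thesis by (simp add: d_def)
qed

text \<open>
  The sign functions at two points of a step may differ outside the chosen set; this
  lemma is what lets the direction be the same along the whole step.
\<close>

lemma equi_cong:
  assumes "\<And>j. j \<in> B \<Longrightarrow> s j = s' j"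
  shows "equi_const X s B = equi_const X s' B" "equi_vec X s B = equi_vec X s' B"
proof -
  have g: "gram X s i j = gram X s' i j" if "i \<in> B" "j \<in> B" for i j
    using assms that by (simp add: gram_def signed_col_def)
  have "is_inverse_on B (gram X s) = is_inverse_on B (gram X s')"
    by (simp add: is_inverse_on_def fun_eq_iff g cong: sum.cong)
  then have i: "inverse_on B (gram X s) = inverse_on B (gram X s')"
    by (simp add: inverse_on_def)
  then show c: "equi_const X s B = equi_const X s' B" by (simp add: equi_const_def)
  show "equi_vec X s B = equi_vec X s' B"
    unfolding equi_vec_def c i using assms by (simp add: signed_col_def)
qed

lemma equi_vel_cong:
  assumes "\<And>j. j \<in> B \<Longrightarrow> s j = s' j"
  shows "equi_vel X s B = equi_vel X s' B"
  using equi_cong[of B s s' X] assms by (simp add: equi_vel_def)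

section \<open>Projection onto the cone of signed columns\<close>

lemma convex_signed_cone: "convex (signed_cone X s A)"
proof (rule convexI)
  fix x y :: "real^'a" and a b :: real
  assume "x \<in> signed_cone X s A" "y \<in> signed_cone X s A" and ab: "0 \<le> a" "0 \<le> b"
  then obtain P Q where "x = (\<Sum>j\<in>A. P j *\<^sub>R signed_col X s j)" "\<forall>j\<in>A. 0 \<le> P j"
    "y = (\<Sum>j\<in>A. Q j *\<^sub>R signed_col X s j)" "\<forall>j\<in>A. 0 \<le> Q j"
    by (auto simp: signed_cone_def)
  with ab show "a *\<^sub>R x + b *\<^sub>R y \<in> signed_cone X s A"
    unfolding signed_cone_def
    by (intro CollectI exI[of _ "\<lambda>j. a * P j + b * Q j"])
       (auto simp: scaleR_sum_right sum.distrib scaleR_add_left)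
qed

lemma closed_signed_cone:
  fixes X :: "real^'m^'n"
  assumes inj: "inj ((*v) X)" and s: "\<forall>j\<in>A. s j \<noteq> 0"
  shows "closed (signed_cone X s A)"
proof -
  let ?R = "{P :: real^'m. \<forall>j. (if j \<in> A then 0 \<le> P $ j / s j else P $ j = 0)}"
  have "signed_cone X s A = (*v) X ` ?R"
  proof (intro equalityI subsetI)
    fix x assume "x \<in> signed_cone X s A"
    then obtain P where "x = (\<Sum>j\<in>A. P j *\<^sub>R signed_col X s j)" "\<forall>j\<in>A. 0 \<le> P j"
      by (auto simp: signed_cone_def)
    then show "x \<in> (*v) X ` ?R"
      using s by (auto simp: signed_comb_as_product)
  next
    fix x assume "x \<in> (*v) X ` ?R"
    then obtain P where x: "x = X *v P" and P: "P \<in> ?R" by auto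
    have "P $ j = (if j \<in> A then (P $ j / s j) * s j else 0)" for j
    proof (cases "j \<in> A")
      case True
      with s show ?thesis by simp
    next
      case False
      with P have "if j \<in> A then 0 \<le> P $ j / s j else P $ j = 0" by blast
      with False show ?thesis by simp
    qed
    then have "P = (\<chi> j. if j \<in> A then (P $ j / s j) * s j else 0)"
      unfolding vec_eq_iff by simp
    then have "x = (\<Sum>j\<in>A. (P $ j / s j) *\<^sub>R signed_col X s j)"
      by (simp add: x signed_comb_as_product)
    then show "x \<in> signed_cone X s A"
      using P by (auto simp: signed_cone_def split: if_splits)
  qed
  moreover have "closed {P :: real^'m. if j \<in> A then 0 \<le> P $ j / s j else P $ j = 0}" for j
    by (cases "j \<in> A")
       (auto intro!: closed_Collect_le closed_Collect_eq continuous_intros simp: divide_inverse)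
  then have "closed ?R" by (rule closed_Collect_all)
  ultimately show ?thesis
    using closed_injective_linear_image_eq[OF matrix_vector_mul_linear inj] by simp
qed

text \<open>
  These are the optimality conditions for \<open>equi_vel X s B\<close> to be the point of least norm of the
  simplex over \<open>A\<close>, with \<open>B\<close> containing its support.
\<close>

definition least_angle_face :: "real^'m^'n \<Rightarrow> ('m \<Rightarrow> real) \<Rightarrow> 'm set \<Rightarrow> 'm set \<Rightarrow> bool" where
  "least_angle_face X s A B \<longleftrightarrow> B \<noteq> {} \<and> B \<subseteq> A \<and> equi_vel X s B \<in> signed_simplex X s B \<and>
     (\<forall>j\<in>A. equi_const X s B \<le> signed_col X s j \<bullet> equi_vec X s B)"

text \<open>
  Let \<open>p\<close> be the projection of \<open>u\<^sub>A\<close>. The optimality conditions say that a signed column has inner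
  product at least as large with \<open>p\<close> as with \<open>u\<^sub>A\<close>, where it is \<open>A\<^sub>A\<close>, and exactly \<open>A\<^sub>A\<close> if its
  coefficient is positive. Thus \<open>p\<close> is equiangular to the columns with positive coefficient and
  therefore proportional to \<open>u\<^sub>B\<close>, and the inequalities scale to those required.
\<close>

lemma projection_face:
  assumes inj: "inj ((*v) X)" and s: "\<forall>j\<in>A. s j \<noteq> 0" and "A \<noteq> {}"
  shows "least_angle_face X s A {j\<in>A. 0 < proj_coeffs X s A j}"
proof -
  define P where "P = proj_coeffs X s A"
  define B where "B = {j\<in>A. 0 < P j}"
  define u where "u = equi_vec X s A"
  define p where "p = closest_point (signed_cone X s A) u"
  let ?g = "signed_col X s"
  note eqA = equi_vec_properties[OF inj s \<open>A \<noteq> {}\<close>]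
  have cone: "(\<Sum>j\<in>A. Q j *\<^sub>R ?g j) \<in> signed_cone X s A" if "\<forall>j\<in>A. 0 \<le> Q j" for Q
    using that by (auto simp: signed_cone_def)
  have closed: "closed (signed_cone X s A)" using closed_signed_cone[OF inj s] .
  have "p \<in> signed_cone X s A"
    unfolding p_def using cone[of "\<lambda>_. 0"] closed by (intro closest_point_in_set) auto
  then have "\<exists>P. (\<forall>j\<in>A. 0 \<le> P j) \<and> (\<Sum>j\<in>A. P j *\<^sub>R ?g j) = p"
    by (auto simp: signed_cone_def)
  then have "(\<forall>j\<in>A. 0 \<le> P j) \<and> (\<Sum>j\<in>A. P j *\<^sub>R ?g j) = p"
    unfolding P_def proj_coeffs_def p_def u_def by (rule someI_ex)
  then have P0: "\<And>j. j \<in> A \<Longrightarrow> 0 \<le> P j" and pP: "p = (\<Sum>j\<in>A. P j *\<^sub>R ?g j)" by auto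
  have var: "(u - p) \<bullet> (x - p) \<le> 0" if "x \<in> signed_cone X s A" for x
    unfolding p_def by (rule closest_point_dot[OF convex_signed_cone closed that])
  \<comment> \<open>Changing one coefficient of \<open>p\<close>: an increase stays in the cone, and so does removing the
    coefficient. These are the points at which the variational inequality is tested.\<close>
  have shift: "(\<Sum>i\<in>A. (P i + (if i = j then c else 0)) *\<^sub>R ?g i) = p + c *\<^sub>R ?g j"
    if "j \<in> A" for j c
  proof -
    have "(\<Sum>i\<in>A. (P i + (if i = j then c else 0)) *\<^sub>R ?g i)
        = p + (\<Sum>i\<in>A. if i = j then c *\<^sub>R ?g j else 0)"
      unfolding pP sum.distrib[symmetric]
      by (intro sum.cong) (auto simp: scaleR_add_left)
    with that show ?thesis by simp
  qed
  have le: "equi_const X s A \<le> ?g j \<bullet> p" if "j \<in> A" for j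
  proof -
    have "p + 1 *\<^sub>R ?g j \<in> signed_cone X s A"
      unfolding shift[OF that, symmetric] using P0 by (intro cone) (auto simp: add_nonneg_nonneg)
    from var[OF this] show ?thesis
      using eqA(2)[OF that] by (simp add: u_def inner_diff_left inner_diff_right inner_commute)
  qed
  have eq: "?g j \<bullet> p = equi_const X s A" if "j \<in> B" for j
  proof -
    have j: "j \<in> A" "0 < P j" using that by (auto simp: B_def)
    have "p + (- P j) *\<^sub>R ?g j \<in> signed_cone X s A"
      unfolding shift[OF j(1), symmetric] using P0 by (intro cone) auto
    from var[OF this] have "0 \<le> (u - p) \<bullet> ?g j"
      using j(2) by (simp add: zero_le_mult_iff)
    with le[OF j(1)] show ?thesis
      using eqA(2)[OF j(1)] by (simp add: u_def inner_diff_left inner_diff_right inner_commute)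
  qed
  have pB: "p = (\<Sum>j\<in>B. P j *\<^sub>R ?g j)"
    unfolding pP using P0 by (intro sum.mono_neutral_right) (force simp: B_def)+
  have "p \<noteq> 0" using le eqA(1) \<open>A \<noteq> {}\<close> by fastforce
  then have "B \<noteq> {}" using pB by auto
  have "B \<subseteq> A" by (auto simp: B_def)
  then have sB: "\<forall>j\<in>B. s j \<noteq> 0" using s by auto
  define K where "K = equi_const X s B"
  define \<kappa> where "\<kappa> = equi_const X s A"
  define v where "v = equi_vec X s B"
  note eqB = equi_vec_properties[OF inj sB \<open>B \<noteq> {}\<close>, folded K_def v_def]
  have pos: "0 < K" "0 < \<kappa>" using eqA(1) eqB(1) by (auto simp: K_def \<kappa>_def)
  have pv: "p = (\<kappa> / K) *\<^sub>R v"
    unfolding \<kappa>_def K_def v_def using eq by (intro equiangular_unique[OF inj sB \<open>B \<noteq> {}\<close> pB]) auto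
  have angle: "K \<le> ?g j \<bullet> v" if "j \<in> A" for j
    using le[OF that] pos by (simp add: pv \<kappa>_def[symmetric] field_simps)
  \<comment> \<open>The weights of \<open>K v\<close>; that they sum to \<open>1\<close> is read off from the inner product with \<open>v\<close>.\<close>
  define Q where "Q j = (K\<^sup>2 / \<kappa>) * P j" for j
  have vQ: "K *\<^sub>R v = (\<Sum>j\<in>B. Q j *\<^sub>R ?g j)"
  proof -
    have "K *\<^sub>R v = (K\<^sup>2 / \<kappa>) *\<^sub>R p" using pos by (simp add: pv power2_eq_square)
    also have "\<dots> = (\<Sum>j\<in>B. Q j *\<^sub>R ?g j)"
      unfolding pB by (simp add: Q_def scaleR_sum_right)
    finally show ?thesis .
  qed
  have "K * sum Q B = (K *\<^sub>R v) \<bullet> v"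
    unfolding vQ using eqB(2) by (simp add: inner_sum_left sum_distrib_left mult.commute)
  also have "\<dots> = K" using eqB(3) by (simp add: norm_eq_1)
  finally have "sum Q B = 1" using pos by simp
  moreover have "\<forall>j\<in>B. 0 \<le> Q j" using pos by (auto simp: Q_def B_def)
  ultimately have "equi_vel X s B \<in> signed_simplex X s B"
    unfolding signed_simplex_def equi_vel_def using vQ by (auto simp: K_def v_def)
  then have "least_angle_face X s A B"
    using \<open>B \<noteq> {}\<close> \<open>B \<subseteq> A\<close> angle by (simp add: least_angle_face_def K_def v_def)
  then show ?thesis by (simp add: B_def P_def)
qed

section \<open>Largest correlations\<close>

lemma abs_corr_le: "\<bar>corr X y \<mu> $ j\<bar> \<le> max_corr X y \<mu>"
  by (simp add: max_corr_def)

lemma max_corr_eqI: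
  assumes "\<And>j. \<bar>corr X y \<mu> $ j\<bar> \<le> C" "\<bar>corr X y \<mu> $ k\<bar> = C"
  shows "max_corr X y \<mu> = C"
  unfolding max_corr_def using assms by (intro Max_eqI) auto

lemma max_set_nonempty: "max_set X y \<mu> \<noteq> {}"
proof -
  have "max_corr X y \<mu> \<in> range (\<lambda>j. \<bar>corr X y \<mu> $ j\<bar>)"
    unfolding max_corr_def by (intro Max_in) auto
  then show ?thesis by (auto simp: max_set_def)
qed

lemma corr_sign_max_set:
  assumes "0 < max_corr X y \<mu>" "j \<in> max_set X y \<mu>"
  shows "corr_sign X y \<mu> j \<in> {1, - 1}" "corr_sign X y \<mu> j \<noteq> 0"
    "corr X y \<mu> $ j = corr_sign X y \<mu> j * max_corr X y \<mu>"
    "corr_sign X y \<mu> j * corr X y \<mu> $ j = max_corr X y \<mu>"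
proof -
  have "corr X y \<mu> $ j \<noteq> 0" using assms by (auto simp: max_set_def)
  then show "corr_sign X y \<mu> j \<in> {1, - 1}" "corr_sign X y \<mu> j \<noteq> 0"
    by (auto simp: corr_sign_def sgn_if)
  show "corr X y \<mu> $ j = corr_sign X y \<mu> j * max_corr X y \<mu>"
    "corr_sign X y \<mu> j * corr X y \<mu> $ j = max_corr X y \<mu>"
    using assms by (auto simp: max_set_def corr_sign_def sgn_if split: if_splits)
qed

text \<open>
  These are the normal equations: vanishing correlations make the residual orthogonal to all fits,
  and otherwise a step along a correlated column shortens it.
\<close>

lemma max_corr_eq_0_iff_ols:
  fixes X :: "real^'m^'n"
  shows "max_corr X y (X *v b) = 0 \<longleftrightarrow> is_ols X y b"
proof
  let ?r = "y - X *v b"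
  assume "max_corr X y (X *v b) = 0"
  then have "corr X y (X *v b) $ j = 0" for j
    using abs_corr_le[of X y "X *v b" j] by simp
  then have orth: "column j X \<bullet> ?r = 0" for j by (simp add: corr_component)
  show "is_ols X y b"
    unfolding is_ols_def
  proof
    fix b'
    have *: "y - X *v b' = ?r + X *v (b - b')"
      by (simp add: matrix_vector_mult_diff_distrib)
    have "?r \<bullet> (X *v (b - b')) = 0"
      unfolding matrix_mult_sum[of X "b - b'"]
      using orth by (simp add: inner_sum_right scalar_mult_eq_scaleR inner_commute)
    then have "(norm (y - X *v b'))\<^sup>2 = (norm ?r)\<^sup>2 + (norm (X *v (b - b')))\<^sup>2"
      unfolding * by (simp add: norm_add_Pythagorean orthogonal_def)
    then show "(norm ?r)\<^sup>2 \<le> (norm (y - X *v b'))\<^sup>2" by simp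
  qed
next
  let ?r = "y - X *v b"
  assume ols: "is_ols X y b"
  have "column j X \<bullet> ?r = 0" for j
  proof (rule ccontr)
    let ?x = "column j X"
    assume ne: "?x \<bullet> ?r \<noteq> 0"
    then have "?x \<noteq> 0" by auto
    \<comment> \<open>The step to the point closest to the residual on the line spanned by the column.\<close>
    define t where "t = (?x \<bullet> ?r) / (?x \<bullet> ?x)"
    have expand: "(norm (r - t *\<^sub>R x))\<^sup>2 = (norm r)\<^sup>2 - 2 * t * (x \<bullet> r) + t\<^sup>2 * (x \<bullet> x)"
      for r x :: "real^'n"
      unfolding power2_norm_eq_inner inner_diff_left inner_diff_right
      by (simp add: inner_commute power2_eq_square)
    have "y - X *v (b + t *\<^sub>R axis j 1) = ?r - t *\<^sub>R ?x"
      by (simp add: matrix_vector_right_distrib matrix_vector_mult_scaleR matrix_vector_mult_basis)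
    then have "(norm ?r)\<^sup>2 \<le> (norm (?r - t *\<^sub>R ?x))\<^sup>2"
      using ols by (metis is_ols_def)
    also have "\<dots> = (norm ?r)\<^sup>2 - 2 * t * (?x \<bullet> ?r) + t\<^sup>2 * (?x \<bullet> ?x)"
      by (rule expand)
    also have "\<dots> = (norm ?r)\<^sup>2 - (?x \<bullet> ?r)\<^sup>2 / (?x \<bullet> ?x)"
      using \<open>?x \<noteq> 0\<close> by (simp add: t_def power2_eq_square field_simps)
    finally have "(?x \<bullet> ?r)\<^sup>2 / (?x \<bullet> ?x) \<le> 0" by simp
    moreover have "0 < (?x \<bullet> ?r)\<^sup>2 / (?x \<bullet> ?x)"
      using ne \<open>?x \<noteq> 0\<close> by (intro divide_pos_pos) auto
    ultimately show False by simp
  qed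
  then show "max_corr X y (X *v b) = 0"
    by (intro max_corr_eqI) (auto simp: corr_component)
qed

section \<open>A single step of the algorithm\<close>

lemma signed_simplex_mono:
  assumes "v \<in> signed_simplex X s B" "B \<subseteq> A" "\<And>j. j \<in> B \<Longrightarrow> s j = s' j"
  shows "v \<in> signed_simplex X s' A"
proof -
  obtain P where P: "v = (\<Sum>j\<in>B. P j *\<^sub>R signed_col X s j)" "\<forall>j\<in>B. 0 \<le> P j" "sum P B = 1"
    using assms(1) by (auto simp: signed_simplex_def)
  let ?Q = "\<lambda>j. if j \<in> B then P j else 0"
  have "(\<Sum>j\<in>A. ?Q j *\<^sub>R signed_col X s' j) = (\<Sum>j\<in>B. ?Q j *\<^sub>R signed_col X s' j)"
    using assms(2) by (intro sum.mono_neutral_right) auto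
  also have "\<dots> = v"
    unfolding P(1) using assms(3) by (intro sum.cong) (auto simp: signed_col_def)
  finally have 1: "v = (\<Sum>j\<in>A. ?Q j *\<^sub>R signed_col X s' j)" by simp
  have "sum ?Q A = sum ?Q B"
    using assms(2) by (intro sum.mono_neutral_right) auto
  also have "\<dots> = 1" using P(3) by simp
  finally have 2: "sum ?Q A = 1" .
  show ?thesis
    unfolding signed_simplex_def using 1 2 P(2) by (intro CollectI exI[of _ ?Q]) auto
qed

lemma signed_simplex_inner_ge:
  assumes "v \<in> signed_simplex X s A" "\<And>j. j \<in> A \<Longrightarrow> c \<le> signed_col X s j \<bullet> w"
  shows "c \<le> v \<bullet> w"
proof -
  obtain P where P: "v = (\<Sum>j\<in>A. P j *\<^sub>R signed_col X s j)" "\<forall>j\<in>A. 0 \<le> P j" "sum P A = 1"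
    using assms(1) by (auto simp: signed_simplex_def)
  have "c = (\<Sum>j\<in>A. P j * c)" using P(3) by (simp flip: sum_distrib_right)
  also have "\<dots> \<le> (\<Sum>j\<in>A. P j * (signed_col X s j \<bullet> w))"
    using P(2) assms(2) by (intro sum_mono mult_left_mono) auto
  also have "\<dots> = v \<bullet> w" by (simp add: P(1) inner_sum_left)
  finally show ?thesis .
qed

text \<open>
  For a sign \<open>\<sigma> = \<plusminus>1\<close>, the amount by which \<open>\<sigma> c\<^sub>j\<close> stays below the maximal correlation is
  \<open>slack \<sigma> j\<close> at the start of the step, and it shrinks at the speed \<open>rate \<sigma> j\<close>. In these terms the
  two families of quotients in the step length become one, and the relevant quotients are the times
  at which a slack is used up.
\<close>

locale lars_step =
  fixes X :: "real^'m^'n" and y \<mu> :: "real^'n"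
  assumes inj_X: "inj ((*v) X)" and max_corr_pos: "0 < max_corr X y \<mu>"
begin

abbreviation "C \<equiv> max_corr X y \<mu>"
abbreviation "A \<equiv> max_set X y \<mu>"
abbreviation "s \<equiv> corr_sign X y \<mu>"
abbreviation "B \<equiv> step_set X y \<mu>"
abbreviation "K \<equiv> equi_const X s B"
abbreviation "u \<equiv> step_dir X y \<mu>"
abbreviation "len \<equiv> step_length X y \<mu>"
abbreviation "slack \<sigma> j \<equiv> C - \<sigma> * corr X y \<mu> $ j"
abbreviation "rate \<sigma> j \<equiv> K - \<sigma> * (column j X \<bullet> u)"
abbreviation "moved \<gamma> \<equiv> \<mu> + \<gamma> *\<^sub>R u"

lemma face: "least_angle_face X s A B"
  unfolding step_set_def using corr_sign_max_set(2)[OF max_corr_pos]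
  by (intro projection_face inj_X max_set_nonempty ballI)

lemma step_set_subset: "B \<subseteq> A" and step_set_nonempty: "B \<noteq> {}"
  using face by (auto simp: least_angle_face_def)

lemma sign_nonzero: "\<forall>j\<in>B. s j \<noteq> 0"
  using step_set_subset corr_sign_max_set(2)[OF max_corr_pos] by blast

lemma sign_unit: "j \<in> A \<Longrightarrow> s j \<in> {1, - 1}"
  by (rule corr_sign_max_set(1)[OF max_corr_pos])

lemma sign_B: "j \<in> B \<Longrightarrow> s j \<in> {1, - 1}"
  using sign_unit step_set_subset by blast

lemma corr_max: "j \<in> A \<Longrightarrow> corr X y \<mu> $ j = s j * C"
  by (rule corr_sign_max_set(3)[OF max_corr_pos])

lemma K_pos: "0 < K"
  by (rule equi_const_pos[OF inj_X sign_nonzero step_set_nonempty])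

lemma norm_u: "norm u = 1"
  unfolding step_dir_def by (rule norm_equi_vec[OF inj_X sign_nonzero step_set_nonempty])

lemma angle_B: "j \<in> B \<Longrightarrow> s j * (column j X \<bullet> u) = K"
  using equi_vec_angle[OF inj_X sign_nonzero step_set_nonempty]
  by (simp add: step_dir_def signed_col_def)

lemma angle_A: "j \<in> A \<Longrightarrow> K \<le> s j * (column j X \<bullet> u)"
  using face by (simp add: least_angle_face_def step_dir_def signed_col_def)

lemma corr_moved: "corr X y (moved \<gamma>) $ j = corr X y \<mu> $ j - \<gamma> * (column j X \<bullet> u)"
  by (simp add: corr_component inner_diff_right inner_add_right)

lemma slack_moved:
  "C - \<gamma> * K - \<sigma> * corr X y (moved \<gamma>) $ j = slack \<sigma> j - \<gamma> * rate \<sigma> j"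
  by (simp add: corr_moved algebra_simps)

lemma slack_nonneg: "\<sigma> \<in> {1, - 1} \<Longrightarrow> 0 \<le> slack \<sigma> j"
  using abs_corr_le[of X y \<mu> j] by (auto simp: abs_le_iff)

text \<open>
  A slack that is already zero belongs to a maximal column with its own sign, and the optimality
  conditions then keep it from becoming negative.
\<close>

lemma slack_eq_0:
  assumes "\<sigma> \<in> {1, - 1}" "slack \<sigma> j = 0"
  shows "j \<in> A" "s j = \<sigma>" "rate \<sigma> j \<le> 0"
proof -
  have c: "corr X y \<mu> $ j = \<sigma> * C" using assms by auto
  then show j: "j \<in> A" using assms(1) max_corr_pos by (auto simp: max_set_def)
  show s: "s j = \<sigma>" using assms(1) max_corr_pos c by (auto simp: corr_sign_def)
  show "rate \<sigma> j \<le> 0" using angle_A[OF j] s by simp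
qed

lemma step_length_full: "B = UNIV \<Longrightarrow> len = C / K"
  by (simp add: step_length_def Let_def)

definition quotients :: "real set" where
  "quotients = {q. 0 < q \<and> (\<exists>j \<sigma>. j \<notin> B \<and> \<sigma> \<in> {1, - 1} \<and> q = slack \<sigma> j / rate \<sigma> j)}"

lemma step_length_Min: "B \<noteq> UNIV \<Longrightarrow> len = Min quotients"
proof -
  assume "B \<noteq> UNIV"
  have "quotients =
      {q. 0 < q \<and> (\<exists>j. j \<notin> B \<and> K - column j X \<bullet> u \<noteq> 0 \<and>
          q = (C - corr X y \<mu> $ j) / (K - column j X \<bullet> u))} \<union>
      {q. 0 < q \<and> (\<exists>j. j \<notin> B \<and> K + column j X \<bullet> u \<noteq> 0 \<and>
          q = (C + corr X y \<mu> $ j) / (K + column j X \<bullet> u))}"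
    unfolding quotients_def by (auto; force)
  with \<open>B \<noteq> UNIV\<close> show ?thesis
    by (simp only: step_length_def Let_def transpose_mult_component if_False)
qed

lemma finite_quotients: "finite quotients"
proof (rule finite_subset)
  show "quotients \<subseteq> (\<lambda>(\<sigma>, j). slack \<sigma> j / rate \<sigma> j) ` ({1, - 1} \<times> UNIV)"
    unfolding quotients_def by auto
qed simp

text \<open>
  For the sign that makes the column point away from the direction of motion, the slack is used up
  at a speed of at least \<open>K\<close>, and it is not already zero because then the speed would not be positive.
\<close>

lemma quotients_nonempty:
  assumes "j \<notin> B" shows "quotients \<noteq> {}"
proof -
  obtain \<sigma> :: real where \<sigma>: "\<sigma> \<in> {1, - 1}" "\<sigma> * (column j X \<bullet> u) \<le> 0"
    by (cases "column j X \<bullet> u \<le> 0") (auto intro: that[of 1] that[of "- 1"])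
  then have r: "0 < rate \<sigma> j" using K_pos by simp
  then have "slack \<sigma> j \<noteq> 0" using slack_eq_0(3)[OF \<sigma>(1), of j] by linarith
  then have "0 < slack \<sigma> j" using slack_nonneg[OF \<sigma>(1), of j] by simp
  with r have "slack \<sigma> j / rate \<sigma> j \<in> quotients"
    unfolding quotients_def using assms \<sigma>(1) by auto
  then show ?thesis by auto
qed

lemma step_length_le:
  assumes "j \<notin> B" "\<sigma> \<in> {1, - 1}" "0 < slack \<sigma> j" "0 < rate \<sigma> j"
  shows "len \<le> slack \<sigma> j / rate \<sigma> j"
proof -
  have "slack \<sigma> j / rate \<sigma> j \<in> quotients"
    unfolding quotients_def using assms divide_pos_pos by blast
  moreover have "B \<noteq> UNIV" using assms(1) by blast
  ultimately show ?thesis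
    unfolding step_length_Min[OF \<open>B \<noteq> UNIV\<close>] using finite_quotients by (intro Min_le)
qed

lemma step_length_attained:
  assumes "B \<noteq> UNIV"
  obtains j \<sigma> where "j \<notin> B" "\<sigma> \<in> {1, - 1}" "0 < slack \<sigma> j" "0 < rate \<sigma> j"
    "len = slack \<sigma> j / rate \<sigma> j"
proof -
  have "quotients \<noteq> {}" using assms quotients_nonempty by blast
  then have "len \<in> quotients"
    unfolding step_length_Min[OF assms] using finite_quotients by (intro Min_in)
  then obtain j \<sigma> where *: "j \<notin> B" "\<sigma> \<in> {1, - 1}" "0 < len" "len = slack \<sigma> j / rate \<sigma> j"
    by (auto simp: quotients_def)
  moreover have "0 < slack \<sigma> j" "0 < rate \<sigma> j"
    using *(3) slack_nonneg[OF *(2), of j] unfolding *(4) by (auto simp: zero_less_divide_iff)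
  ultimately show thesis by (intro that)
qed

lemma step_length_pos: "0 < len"
proof (cases "B = UNIV")
  case True
  then show ?thesis using max_corr_pos K_pos by (simp add: step_length_full)
next
  case False
  then show ?thesis by (elim step_length_attained) simp
qed

lemma slack_moved_bounds:
  assumes "0 \<le> \<gamma>" "\<gamma> \<le> len" "j \<notin> B" and \<sigma>: "\<sigma> \<in> {1, - 1}"
  shows "0 \<le> C - \<gamma> * K - \<sigma> * corr X y (moved \<gamma>) $ j"
    and "\<gamma> < len \<Longrightarrow> 0 < slack \<sigma> j \<Longrightarrow> 0 < C - \<gamma> * K - \<sigma> * corr X y (moved \<gamma>) $ j"
proof -
  define a r where "a = slack \<sigma> j" and "r = rate \<sigma> j"
  have a: "0 \<le> a" using slack_nonneg[OF \<sigma>, of j] by (simp only: a_def)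
  consider "r \<le> 0" | "0 < r" "0 < a"
    using a slack_eq_0(3)[OF \<sigma>, of j, folded a_def r_def] by linarith
  then have "0 \<le> a - \<gamma> * r \<and> (\<gamma> < len \<longrightarrow> 0 < a \<longrightarrow> 0 < a - \<gamma> * r)"
  proof cases
    case 1
    with assms(1) have "\<gamma> * r \<le> 0" by (rule mult_nonneg_nonpos)
    then show ?thesis using a by auto
  next
    case 2
    have "len \<le> a / r"
      using step_length_le[OF assms(3) \<sigma>, folded a_def r_def] 2 by blast
    then have "len * r \<le> a" by (simp only: pos_le_divide_eq[OF 2(1)])
    moreover have "\<gamma> * r \<le> len * r" using assms(2) 2(1) by (intro mult_right_mono) auto
    moreover have "\<gamma> < len \<Longrightarrow> \<gamma> * r < len * r" 
      using mult_strict_right_mono[OF _ 2(1)] by blast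
    ultimately show ?thesis by linarith
  qed
  then show "0 \<le> C - \<gamma> * K - \<sigma> * corr X y (moved \<gamma>) $ j"
    "\<gamma> < len \<Longrightarrow> 0 < slack \<sigma> j \<Longrightarrow> 0 < C - \<gamma> * K - \<sigma> * corr X y (moved \<gamma>) $ j"
    unfolding slack_moved a_def r_def by blast+
qed

lemma max_corr_moved_nonneg:
  assumes "0 \<le> \<gamma>" "\<gamma> \<le> len"
  shows "0 \<le> C - \<gamma> * K"
proof (cases "B = UNIV")
  case True
  from assms(2) show ?thesis
    unfolding step_length_full[OF True] pos_le_divide_eq[OF K_pos] by simp
next
  case False
  then obtain j where "j \<notin> B" by auto
  from slack_moved_bounds(1)[OF assms this, of 1] slack_moved_bounds(1)[OF assms this, of "- 1"]
  show ?thesis by simp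
qed

lemma corr_moved_B: "j \<in> B \<Longrightarrow> corr X y (moved \<gamma>) $ j = s j * (C - \<gamma> * K)"
proof -
  assume j: "j \<in> B"
  with step_set_subset have jA: "j \<in> A" by auto
  have "s j * s j = 1" using sign_unit[OF jA] by auto
  then have "column j X \<bullet> u = s j * (s j * (column j X \<bullet> u))"
    by (simp flip: mult.assoc)
  also have "\<dots> = s j * K" by (simp only: angle_B[OF j])
  finally have "column j X \<bullet> u = s j * K" .
  then show ?thesis by (simp add: corr_moved corr_max[OF jA] algebra_simps)
qed

text \<open>
  The chosen columns attain \<open>C - \<gamma> K\<close>, and no other column can exceed it before its slack is used up.
\<close>

lemma max_corr_moved:
  assumes "0 \<le> \<gamma>" "\<gamma> \<le> len"
  shows "max_corr X y (moved \<gamma>) = C - \<gamma> * K"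
proof -
  have B: "\<bar>corr X y (moved \<gamma>) $ j\<bar> = C - \<gamma> * K" if "j \<in> B" for j
    using sign_B[OF that] max_corr_moved_nonneg[OF assms]
    by (auto simp: corr_moved_B[OF that])
  obtain k where "k \<in> B" using step_set_nonempty by auto
  show ?thesis
  proof (rule max_corr_eqI[OF _ B[OF \<open>k \<in> B\<close>]])
    fix j
    show "\<bar>corr X y (moved \<gamma>) $ j\<bar> \<le> C - \<gamma> * K"
    proof (cases "j \<in> B")
      case False
      from slack_moved_bounds(1)[OF assms False, of 1] slack_moved_bounds(1)[OF assms False, of "- 1"]
      show ?thesis by simp
    qed (simp add: B)
  qed
qed

lemma max_corr_moved_pos:
  assumes "0 \<le> \<gamma>" "\<gamma> < len"
  shows "0 < max_corr X y (moved \<gamma>)"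
proof -
  have "\<gamma> * K < len * K" using assms K_pos by simp
  then show ?thesis
    using max_corr_moved_nonneg[of len] max_corr_moved[of \<gamma>] assms by simp
qed

lemma moved_B:
  assumes "0 \<le> \<gamma>" "\<gamma> \<le> len" "0 < max_corr X y (moved \<gamma>)" "j \<in> B"
  shows "j \<in> max_set X y (moved \<gamma>)" "corr_sign X y (moved \<gamma>) j = s j"
  using assms(3) sign_B[OF assms(4)] unfolding max_corr_moved[OF assms(1,2)]
  by (auto simp: max_set_def corr_sign_def[of X y "moved \<gamma>"] corr_moved_B[OF assms(4)]
      max_corr_moved[OF assms(1,2)])

text \<open>
  No column joins the maximal set strictly inside a step, although maximal columns outside the
  chosen set may leave it as soon as \<open>\<gamma> > 0\<close>.
\<close>

lemma moved_A:
  assumes "0 \<le> \<gamma>" "\<gamma> < len" and j: "j \<in> max_set X y (moved \<gamma>)"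
  shows "j \<in> A" "corr_sign X y (moved \<gamma>) j = s j"
proof -
  let ?\<sigma> = "corr_sign X y (moved \<gamma>) j"
  note pos = max_corr_moved_pos[OF assms(1,2)]
  have \<sigma>: "?\<sigma> \<in> {1, - 1}" by (rule corr_sign_max_set(1)[OF pos j])
  have "?\<sigma> * corr X y (moved \<gamma>) $ j = C - \<gamma> * K"
    by (rule trans[OF corr_sign_max_set(4)[OF pos j]
          max_corr_moved[OF assms(1) less_imp_le[OF assms(2)]]])
  then have "slack ?\<sigma> j = 0" if "j \<notin> B"
    using slack_moved_bounds(2)[OF assms(1) less_imp_le[OF assms(2)] that \<sigma> assms(2)]
      slack_nonneg[OF \<sigma>, of j] by linarith
  then have "j \<in> A \<and> s j = ?\<sigma>" if "j \<notin> B"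
    using slack_eq_0[OF \<sigma>, of j] that by auto
  moreover have "j \<in> A \<and> s j = ?\<sigma>" if "j \<in> B"
    using moved_B(2)[OF assms(1) _ pos that] assms(2) step_set_subset that by auto
  ultimately have *: "j \<in> A \<and> s j = ?\<sigma>" by blast
  from * show "j \<in> A" by (rule conjunct1)
  from * show "?\<sigma> = s j" by (rule conjunct2[THEN sym])
qed

lemma equi_vel_step: "equi_vel X s B = K *\<^sub>R u"
  by (simp add: equi_vel_def step_dir_def)

lemma stagewise_velocity_moved:
  assumes "0 \<le> \<gamma>" "\<gamma> < len"
  shows "stagewise_velocity X y (moved \<gamma>) (K *\<^sub>R u)"
proof -
  let ?s = "corr_sign X y (moved \<gamma>)" and ?A = "max_set X y (moved \<gamma>)"
  note B = moved_B[OF assms(1) less_imp_le[OF assms(2)] max_corr_moved_pos[OF assms]]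
  have vel: "equi_vel X ?s B = K *\<^sub>R u" and const: "equi_const X ?s B = K"
    using equi_vel_cong[of B ?s s X] equi_cong(1)[of B ?s s X] B(2) equi_vel_step by auto
  have "K *\<^sub>R u \<in> signed_simplex X s B"
    using face by (simp add: least_angle_face_def equi_vel_step)
  then have simplex: "K *\<^sub>R u \<in> signed_simplex X ?s ?A"
    by (rule signed_simplex_mono) (use B in auto)
  have "K\<^sup>2 \<le> ?s j * (column j X \<bullet> K *\<^sub>R u)" if "j \<in> ?A" for j
    using angle_A[of j] moved_A[OF assms that] K_pos
    by (simp add: power2_eq_square mult.left_commute mult_left_mono)
  then show ?thesis
    unfolding stagewise_velocity_def Let_def
    using vel const simplex B(1) step_set_nonempty by (intro exI[of _ B]) auto
qed

text \<open>
  The old velocity still lies in the new simplex, since the chosen columns stay maximal with their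
  signs. As \<open>A\<^sub>B\<close> is the norm of the velocity and the new velocity has least norm in the new simplex,
  the constant cannot increase. Equality would force the direction to be unchanged, but the column
  whose slack has just been used up has inner product less than \<open>K\<close> with the old direction,
  against the optimality of the new one.
\<close>

lemma equi_const_next_less:
  assumes next_pos: "0 < max_corr X y (moved len)"
  shows "equi_const X (corr_sign X y (moved len)) (step_set X y (moved len)) < K"
proof -
  interpret nxt: lars_step X y "moved len"
    using inj_X next_pos by unfold_locales
  note len = less_imp_le[OF step_length_pos]
  have "B \<noteq> UNIV"
    using next_pos max_corr_moved[OF len] K_pos by (auto simp: step_length_full)
  then obtain j \<sigma> where j: "j \<notin> B" "\<sigma> \<in> {1, - 1}" "0 < slack \<sigma> j" "0 < rate \<sigma> j"
    and len_eq: "len = slack \<sigma> j / rate \<sigma> j" by (rule step_length_attained)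
  have "slack \<sigma> j - len * rate \<sigma> j = 0" using j(4) by (simp add: len_eq)
  then have "nxt.slack \<sigma> j = 0"
    using slack_moved[of len \<sigma> j] max_corr_moved[OF len] by simp
  note new = nxt.slack_eq_0[OF j(2) this]
  note B = moved_B[OF len order_refl next_pos]
  have "K *\<^sub>R u \<in> signed_simplex X s B"
    using face by (simp add: least_angle_face_def equi_vel_step)
  then have "K *\<^sub>R u \<in> signed_simplex X nxt.s nxt.A"
    by (rule signed_simplex_mono) (use B in auto)
  then have "nxt.K \<le> K *\<^sub>R u \<bullet> nxt.u"
    by (rule signed_simplex_inner_ge) (use nxt.angle_A in \<open>simp add: signed_col_def\<close>)
  then have le: "nxt.K \<le> K * (u \<bullet> nxt.u)" by simp
  have dot: "u \<bullet> nxt.u \<le> 1"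
    using norm_cauchy_schwarz[of u nxt.u] norm_u nxt.norm_u by simp
  have "nxt.K \<noteq> K"
  proof
    assume eq: "nxt.K = K"
    with le K_pos have "1 \<le> u \<bullet> nxt.u" by simp
    with dot have "u \<bullet> nxt.u = 1" by simp
    then have "(u - nxt.u) \<bullet> (u - nxt.u) = 0"
      using norm_u nxt.norm_u by (simp add: norm_eq_1 inner_diff_left inner_diff_right inner_commute)
    then have "u = nxt.u" by simp
    with new(3) eq j(4) show False by simp
  qed
  moreover have "nxt.K \<le> K"
    using le mult_left_mono[OF dot less_imp_le[OF K_pos]] by linarith
  ultimately show ?thesis by simp
qed

end

section \<open>Polygonal paths\<close>

text \<open>
  The path that runs through the segments \<open>\<delta> i *\<^sub>R d i\<close> one after the other, spending time \<open>\<delta> i\<close> on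
  each. Writing it as one sum of clamped terms gives continuity and monotonicity without gluing.
\<close>

definition polygonal :: "(nat \<Rightarrow> real) \<Rightarrow> (nat \<Rightarrow> 'a::real_normed_vector) \<Rightarrow> nat \<Rightarrow> real \<Rightarrow> 'a" where
  "polygonal \<delta> d n t = (\<Sum>i<n. max 0 (min (t - sum \<delta> {..<i}) (\<delta> i)) *\<^sub>R d i)"

lemma knot_mono:
  fixes \<delta> :: "nat \<Rightarrow> real"
  assumes "\<And>i. i < n \<Longrightarrow> 0 < \<delta> i" "i \<le> j" "j \<le> n"
  shows "sum \<delta> {..<i} \<le> sum \<delta> {..<j}"
  using assms by (intro sum_mono2) (auto intro!: less_imp_le)

lemma knot_interval:
  fixes \<delta> :: "nat \<Rightarrow> real"
  assumes "0 \<le> t" "t < sum \<delta> {..<n}"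
  obtains k where "k < n" "sum \<delta> {..<k} \<le> t" "t < sum \<delta> {..<Suc k}"
proof -
  have "\<exists>k<n. sum \<delta> {..<k} \<le> t \<and> t < sum \<delta> {..<Suc k}"
    using assms(2)
  proof (induction n)
    case 0
    then show ?case using assms(1) by simp
  next
    case (Suc n)
    show ?case
    proof (cases "t < sum \<delta> {..<n}")
      case True
      with Suc.IH show ?thesis using less_SucI by blast
    next
      case False
      with Suc.prems show ?thesis by (intro exI[of _ n]) simp
    qed
  qed
  then show thesis using that by blast
qed

lemma polygonal_segment:
  assumes pos: "\<And>i. i < n \<Longrightarrow> 0 < \<delta> i" and k: "k < n"
    and t: "sum \<delta> {..<k} \<le> t" "t \<le> sum \<delta> {..<Suc k}"
  shows "polygonal \<delta> d n t = (\<Sum>i<k. \<delta> i *\<^sub>R d i) + (t - sum \<delta> {..<k}) *\<^sub>R d k"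
proof -
  let ?c = "\<lambda>i. max 0 (min (t - sum \<delta> {..<i}) (\<delta> i))"
  have before: "?c i = \<delta> i" if "i < k" for i
    using knot_mono[of n \<delta> "Suc i" k] pos[of i] k t(1) that pos by simp
  have at: "?c k = t - sum \<delta> {..<k}" using t by simp
  have after: "?c i = 0" if "i < n" "\<not> i < Suc k" for i
    using knot_mono[of n \<delta> "Suc k" i] k t(2) that pos by simp
  have "polygonal \<delta> d n t = (\<Sum>i<Suc k. ?c i *\<^sub>R d i)"
    unfolding polygonal_def using k after by (intro sum.mono_neutral_right) auto
  also have "\<dots> = (\<Sum>i<k. \<delta> i *\<^sub>R d i) + (t - sum \<delta> {..<k}) *\<^sub>R d k"
    unfolding sum.lessThan_Suc at by (simp add: before)
  finally show ?thesis .
qed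

lemma polygonal_start:
  assumes "\<And>i. i < n \<Longrightarrow> 0 < \<delta> i"
  shows "polygonal \<delta> d n 0 = 0"
proof -
  have "min (0 - sum \<delta> {..<i}) (\<delta> i) \<le> 0" if "i < n" for i
    using knot_mono[of n \<delta> 0 i] assms that by (intro min.coboundedI1) simp
  then show ?thesis unfolding polygonal_def by (intro sum.neutral) auto
qed

lemma polygonal_end:
  assumes "\<And>i. i < n \<Longrightarrow> 0 < \<delta> i"
  shows "polygonal \<delta> d n (sum \<delta> {..<n}) = (\<Sum>i<n. \<delta> i *\<^sub>R d i)"
  unfolding polygonal_def
proof (intro sum.cong refl)
  fix i assume "i \<in> {..<n}"
  then have "max 0 (min (sum \<delta> {..<n} - sum \<delta> {..<i}) (\<delta> i)) = \<delta> i"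
    using knot_mono[of n \<delta> "Suc i" n] assms[of i] assms by simp
  then show "max 0 (min (sum \<delta> {..<n} - sum \<delta> {..<i}) (\<delta> i)) *\<^sub>R d i = \<delta> i *\<^sub>R d i" by simp
qed

lemma continuous_on_polygonal: "continuous_on S (polygonal \<delta> d n)"
  unfolding polygonal_def by (intro continuous_intros)

lemma polygonal_right_derivative:
  assumes pos: "\<And>i. i < n \<Longrightarrow> 0 < \<delta> i" and k: "k < n"
    and t: "sum \<delta> {..<k} \<le> t" "t < sum \<delta> {..<Suc k}"
  shows "(polygonal \<delta> d n has_vector_derivative d k) (at_right t)"
proof -
  let ?f = "\<lambda>t. (\<Sum>i<k. \<delta> i *\<^sub>R d i) + (t - sum \<delta> {..<k}) *\<^sub>R d k"
  have "(?f has_vector_derivative d k) (at t within {t..})"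
    by (auto intro!: derivative_eq_intros)
  then have "(polygonal \<delta> d n has_vector_derivative d k) (at t within {t..})"
  proof (rule has_vector_derivative_transform_within)
    show "0 < sum \<delta> {..<Suc k} - t" using t by simp
    show "?f x = polygonal \<delta> d n x"
      if "x \<in> {t..}" "dist x t < sum \<delta> {..<Suc k} - t" for x
      using polygonal_segment[of n \<delta> k x d] pos k t that by (simp add: dist_real_def)
  qed simp
  then show ?thesis by (rule has_vector_derivative_within_subset) auto
qed

lemma strict_mono_polygonal:
  fixes d :: "nat \<Rightarrow> real"
  assumes pos: "\<And>i. i < n \<Longrightarrow> 0 < \<delta> i" "\<And>i. i < n \<Longrightarrow> 0 < d i"
  shows "strict_mono_on {0..sum \<delta> {..<n}} (polygonal \<delta> d n)"
proof (rule strict_mono_onI)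
  fix a b assume ab: "a \<in> {0..sum \<delta> {..<n}}" "b \<in> {0..sum \<delta> {..<n}}" "a < b"
  then obtain k where k: "k < n" "sum \<delta> {..<k} \<le> a" "a < sum \<delta> {..<Suc k}"
    using knot_interval[of a \<delta> n] by auto
  show "polygonal \<delta> d n a < polygonal \<delta> d n b"
    unfolding polygonal_def real_scaleR_def
  proof (rule sum_strict_mono_ex1)
    show "\<forall>i\<in>{..<n}. max 0 (min (a - sum \<delta> {..<i}) (\<delta> i)) * d i
        \<le> max 0 (min (b - sum \<delta> {..<i}) (\<delta> i)) * d i"
      using ab(3) pos(2) by (intro ballI mult_right_mono) (auto intro!: less_imp_le max.mono min.mono)
    show "\<exists>i\<in>{..<n}. max 0 (min (a - sum \<delta> {..<i}) (\<delta> i)) * d i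
        < max 0 (min (b - sum \<delta> {..<i}) (\<delta> i)) * d i"
    proof (rule bexI[of _ k], rule mult_strict_right_mono)
      show "max 0 (min (a - sum \<delta> {..<k}) (\<delta> k)) < max 0 (min (b - sum \<delta> {..<k}) (\<delta> k))"
        using ab(3) k pos(1)[OF k(1)] by simp
    qed (use k pos(2) in auto)
  qed simp
qed

text \<open>
  Running through the segments at speeds \<open>\<kappa> i\<close> times the velocities \<open>d i\<close> is the path with velocities
  \<open>d i\<close> composed with the polygonal time change of slopes \<open>\<kappa> i\<close>.
\<close>

lemma polygonal_reparametrization:
  assumes pos: "\<And>i. i < n \<Longrightarrow> 0 < \<delta> i" "\<And>i. i < n \<Longrightarrow> 0 < \<kappa> i"
    and t: "t \<in> {0..sum \<delta> {..<n}}"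
  shows "polygonal \<delta> (\<lambda>i. \<kappa> i *\<^sub>R d i) n t
       = polygonal (\<lambda>i. \<kappa> i * \<delta> i) d n (polygonal \<delta> \<kappa> n t)"
proof (cases "t < sum \<delta> {..<n}")
  case True
  with t obtain k where k: "k < n" "sum \<delta> {..<k} \<le> t" "t < sum \<delta> {..<Suc k}"
    using knot_interval[of t \<delta> n] by auto
  let ?l = "\<lambda>i. \<kappa> i * \<delta> i"
  have l: "\<And>i. i < n \<Longrightarrow> 0 < ?l i" using pos by simp
  have h: "polygonal \<delta> \<kappa> n t = sum ?l {..<k} + \<kappa> k * (t - sum \<delta> {..<k})"
    using polygonal_segment[of n \<delta> k t \<kappa>] pos(1) k by (simp add: mult.commute)
  have "polygonal ?l d n (polygonal \<delta> \<kappa> n t)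
      = (\<Sum>i<k. ?l i *\<^sub>R d i) + (polygonal \<delta> \<kappa> n t - sum ?l {..<k}) *\<^sub>R d k"
  proof (rule polygonal_segment[OF l k(1)])
    show "sum ?l {..<k} \<le> polygonal \<delta> \<kappa> n t"
      using k pos(2)[OF k(1)] by (simp add: h)
    show "polygonal \<delta> \<kappa> n t \<le> sum ?l {..<Suc k}"
      using k pos(2)[OF k(1)] by (simp add: h)
  qed
  also have "\<dots> = polygonal \<delta> (\<lambda>i. \<kappa> i *\<^sub>R d i) n t"
    using polygonal_segment[of n \<delta> k t "\<lambda>i. \<kappa> i *\<^sub>R d i"] pos(1) k by (simp add: h mult.commute)
  finally show ?thesis by simp
next
  case False
  with t have t: "t = sum \<delta> {..<n}" by simp
  have "polygonal \<delta> \<kappa> n t = (\<Sum>i<n. \<kappa> i * \<delta> i)"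
    using polygonal_end[of n \<delta> \<kappa>] pos(1) by (simp add: t mult.commute)
  then show ?thesis
    using polygonal_end[of n "\<lambda>i. \<kappa> i * \<delta> i" d] polygonal_end[of n \<delta> "\<lambda>i. \<kappa> i *\<^sub>R d i"] pos
    by (simp add: t mult.commute)
qed

lemma polygonal_image:
  fixes \<kappa> :: "nat \<Rightarrow> real"
  assumes pos: "\<And>i. i < n \<Longrightarrow> 0 < \<delta> i" "\<And>i. i < n \<Longrightarrow> 0 < \<kappa> i"
  shows "polygonal \<delta> \<kappa> n ` {0..sum \<delta> {..<n}} = {0..\<Sum>i<n. \<kappa> i * \<delta> i}"
proof -
  let ?h = "polygonal \<delta> \<kappa> n" and ?T = "sum \<delta> {..<n}"
  have T: "0 \<le> ?T" using pos(1) by (intro sum_nonneg less_imp_le) auto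
  have ends: "?h 0 = 0" "?h ?T = (\<Sum>i<n. \<kappa> i * \<delta> i)"
    using polygonal_start[of n \<delta> \<kappa>] polygonal_end[of n \<delta> \<kappa>] pos(1) by (auto simp: mult.commute)
  have "?h z \<in> {?h 0..?h ?T}" if "z \<in> {0..?T}" for z
    using strict_mono_on_leD[OF strict_mono_polygonal[OF pos]] that T by auto
  moreover have "\<exists>z\<in>{0..?T}. ?h z = w" if "w \<in> {?h 0..?h ?T}" for w
    using IVT'[of ?h 0 w ?T] that T continuous_on_polygonal[of _ \<delta> \<kappa> n]
    unfolding Bex_def by auto
  ultimately show ?thesis unfolding ends by force
qed

section \<open>Uniqueness of Stagewise tracks\<close>

text \<open>
  For every slope \<open>\<epsilon> > 0\<close>, the last point up to \<open>b\<close> where \<open>f\<close> is not above the line \<open>\<epsilon> x\<close> must be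
  \<open>b\<close> itself, since from any earlier such point the right derivative keeps \<open>f\<close> below the line a
  little longer.
\<close>

lemma right_derivative_nonpos_imp_nonpos:
  fixes f :: "real \<Rightarrow> real"
  assumes cont: "continuous_on {0..S} f" and start: "f 0 \<le> 0"
    and der: "\<And>x. x \<in> {0..<S} \<Longrightarrow> \<exists>D\<le>0. (f has_vector_derivative D) (at_right x)"
    and b: "b \<in> {0..S}"
  shows "f b \<le> 0"
proof (rule field_le_epsilon)
  fix e :: real assume "0 < e"
  \<comment> \<open>Dividing by \<open>b + 1\<close> rather than \<open>b\<close> covers \<open>b = 0\<close>.\<close>
  define \<epsilon> where "\<epsilon> = e / (b + 1)"
  have \<epsilon>: "0 < \<epsilon>" "\<epsilon> * b \<le> e"
    using \<open>0 < e\<close> b by (auto simp: \<epsilon>_def field_simps)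
  define Z where "Z = {x \<in> {0..b}. f x \<le> \<epsilon> * x}"
  have cont_b: "continuous_on {0..b} f" using cont by (rule continuous_on_subset) (use b in auto)
  have "closed Z"
    unfolding Z_def by (intro continuous_on_closed_Collect_le
        continuous_intros cont_b closed_atLeastAtMost)
  moreover have "Z \<noteq> {}" using start b by (auto simp: Z_def)
  moreover have bdd: "bdd_above Z" by (auto simp: Z_def)
  ultimately have "Sup Z \<in> Z" by (intro closed_contains_Sup)
  define c where "c = Sup Z"
  have c: "c \<in> {0..b}" "f c \<le> \<epsilon> * c" using \<open>Sup Z \<in> Z\<close> by (auto simp: Z_def c_def)
  have "c = b"
  proof (rule ccontr)
    assume "c \<noteq> b"
    with c b have "c < b" "c \<in> {0..<S}" by auto
    then obtain D where D: "D \<le> 0" "(f has_vector_derivative D) (at_right c)" using der by blast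
    then have "((\<lambda>x. (f x - f c) / (x - c)) \<longlongrightarrow> D) (at_right c)"
      by (simp add: has_real_derivative_iff_has_vector_derivative[symmetric] has_field_derivative_iff)
    then have "\<forall>\<^sub>F x in at_right c. (f x - f c) / (x - c) < \<epsilon>"
      using D(1) \<epsilon>(1) by (intro order_tendstoD(2)[of _ D]) auto
    moreover have "\<forall>\<^sub>F x in at_right c. x < b \<and> c < x"
      using eventually_at_right_real[OF \<open>c < b\<close>] by (rule eventually_mono) auto
    ultimately have "\<forall>\<^sub>F x in at_right c. (f x - f c) / (x - c) < \<epsilon> \<and> x < b \<and> c < x"
      by (rule eventually_conj)
    then obtain x where x: "(f x - f c) / (x - c) < \<epsilon>" "x < b" "c < x"
      using eventually_happens[of _ "at_right c"] by (auto simp: trivial_limit_at_right_real)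
    then have "f x - f c < \<epsilon> * (x - c)" by (simp add: pos_divide_less_eq)
    with c have "f x \<le> \<epsilon> * x" by (simp add: algebra_simps)
    with x c have "x \<in> Z" by (auto simp: Z_def)
    then have "x \<le> c" unfolding c_def using bdd by (rule cSup_upper)
    with x(3) show False by simp
  qed
  with c(2) \<epsilon>(2) show "f b \<le> 0 + e" by simp
qed

text \<open>
  The subgradient inequality for the convex function \<open>max_corr X y\<close>, with \<open>-v\<close> as the subgradient: for \<open>v\<close> in the simplex of
  the signed columns at \<open>\<mu>\<close>, the function \<open>v \<bullet> (y - \<cdot>)\<close> is a convex combination of signed correlations,
  so it equals the maximum at \<open>\<mu>\<close> and is at most the maximum at any other fit.
\<close>

lemma simplex_subgradient:
  assumes pos: "0 < max_corr X y \<mu>" and v: "v \<in> signed_simplex X (corr_sign X y \<mu>) (max_set X y \<mu>)"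
  shows "max_corr X y \<mu> + v \<bullet> (\<mu> - \<nu>) \<le> max_corr X y \<nu>"
proof -
  let ?g = "signed_col X (corr_sign X y \<mu>)"
  have here: "?g j \<bullet> (y - \<mu>) = max_corr X y \<mu>" and there: "?g j \<bullet> (y - \<nu>) \<le> max_corr X y \<nu>"
    if "j \<in> max_set X y \<mu>" for j
    using corr_sign_max_set(1,3)[OF pos that] abs_corr_le[of X y \<nu> j]
    by (auto simp: signed_col_def corr_component[symmetric])
  have "max_corr X y \<mu> \<le> v \<bullet> (y - \<mu>)"
    by (rule signed_simplex_inner_ge[OF v]) (simp add: here)
  moreover have "- max_corr X y \<nu> \<le> v \<bullet> (- (y - \<nu>))"
    by (rule signed_simplex_inner_ge[OF v]) (simp only: inner_minus_right neg_le_iff_le there)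
  ultimately show ?thesis by (simp add: inner_diff_right)
qed

lemma simplex_monotone:
  assumes "0 < max_corr X y \<mu>" "v \<in> signed_simplex X (corr_sign X y \<mu>) (max_set X y \<mu>)"
    and "0 < max_corr X y \<nu>" "w \<in> signed_simplex X (corr_sign X y \<nu>) (max_set X y \<nu>)"
  shows "(\<mu> - \<nu>) \<bullet> (v - w) \<le> 0"
  using simplex_subgradient[OF assms(1,2), of \<nu>] simplex_subgradient[OF assms(3,4), of \<mu>]
  by (simp add: inner_diff_left inner_diff_right inner_commute)

lemma stagewise_velocity_simplex:
  "stagewise_velocity X y \<mu> v \<Longrightarrow> v \<in> signed_simplex X (corr_sign X y \<mu>) (max_set X y \<mu>)"
  by (auto simp: stagewise_velocity_def Let_def)

lemma stagewise_fits_agree: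
  assumes 1: "stagewise_track X y T \<beta>" and 2: "stagewise_track X y T' \<beta>'"
    and z: "z \<in> {0..min T T'}"
  shows "X *v \<beta> z = X *v \<beta>' z"
proof -
  define D where "D t = X *v \<beta> t - X *v \<beta>' t" for t
  have "D z \<bullet> D z \<le> 0"
  proof (rule right_derivative_nonpos_imp_nonpos[OF _ _ _ z])
    have "continuous_on {0..min T T'} \<beta>" "continuous_on {0..min T T'} \<beta>'"
      using 1 2 by (auto simp: stagewise_track_def elim!: continuous_on_subset)
    then show "continuous_on {0..min T T'} (\<lambda>t. D t \<bullet> D t)"
      unfolding D_def
      by (intro continuous_intros bounded_linear.continuous_on[OF matrix_vector_mul_bounded_linear])
    show "D 0 \<bullet> D 0 \<le> 0" using 1 2 by (simp add: D_def stagewise_track_def)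
    fix x assume x: "x \<in> {0..<min T T'}"
    obtain v where v: "((\<lambda>t. X *v \<beta> t) has_vector_derivative v) (at_right x)"
        "0 < max_corr X y (X *v \<beta> x)" "stagewise_velocity X y (X *v \<beta> x) v"
      using 1 x unfolding stagewise_track_def by (meson atLeastLessThan_iff min_less_iff_conj)
    obtain w where w: "((\<lambda>t. X *v \<beta>' t) has_vector_derivative w) (at_right x)"
        "0 < max_corr X y (X *v \<beta>' x)" "stagewise_velocity X y (X *v \<beta>' x) w"
      using 2 x unfolding stagewise_track_def by (meson atLeastLessThan_iff min_less_iff_conj)
    have "(D has_vector_derivative v - w) (at_right x)"
      unfolding D_def by (intro has_vector_derivative_diff v w)
    then have "((\<lambda>t. D t \<bullet> D t) has_vector_derivative D x \<bullet> (v - w) + (v - w) \<bullet> D x) (at_right x)"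
      by (rule bounded_bilinear.has_vector_derivative[OF bounded_bilinear_inner]) fact
    moreover have "D x \<bullet> (v - w) \<le> 0"
      unfolding D_def using v w by (intro simplex_monotone stagewise_velocity_simplex) auto
    ultimately show "\<exists>E\<le>0. ((\<lambda>t. D t \<bullet> D t) has_vector_derivative E) (at_right x)"
      by (intro exI[of _ "D x \<bullet> (v - w) + (v - w) \<bullet> D x"]) (simp add: inner_commute)
  qed
  then have "D z = 0" using inner_gt_zero_iff[of "D z"] by linarith
  then show ?thesis by (simp add: D_def)
qed

text \<open>
  If the second track lasted longer, its fit at the end of the first would be the least squares
  fit while its maximal correlation is still positive.
\<close>

lemma stagewise_duration_le:
  assumes 1: "stagewise_track X y T \<beta>" and 2: "stagewise_track X y T' \<beta>'"
  shows "T' \<le> T"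
proof (rule ccontr)
  assume "\<not> T' \<le> T"
  moreover have "0 \<le> T" using 1 by (simp add: stagewise_track_def)
  ultimately have T: "T \<in> {0..<T'}" "T \<in> {0..min T T'}" by auto
  have "max_corr X y (X *v \<beta> T) = 0"
    using 1 by (simp add: stagewise_track_def max_corr_eq_0_iff_ols)
  moreover have "0 < max_corr X y (X *v \<beta>' T)"
    using 2 T(1) by (auto simp: stagewise_track_def)
  ultimately show False using stagewise_fits_agree[OF 1 2 T(2)] by simp
qed

lemma stagewise_track_unique:
  assumes inj: "inj ((*v) X)"
    and 1: "stagewise_track X y T \<beta>" and 2: "stagewise_track X y T' \<beta>'"
  shows "T' = T" "\<And>z. z \<in> {0..T} \<Longrightarrow> \<beta>' z = \<beta> z"
proof -
  show T: "T' = T" using stagewise_duration_le 1 2 by (metis order_antisym)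
  show "\<beta>' z = \<beta> z" if "z \<in> {0..T}" for z
    using stagewise_fits_agree[OF 1 2] that T by (auto intro: injD[OF inj])
qed

section \<open>Termination and existence\<close>

lemma max_corr_nonneg: "0 \<le> max_corr X y \<mu>"
  using abs_corr_le abs_ge_zero order_trans by blast

abbreviation lars_const :: "real^'m^'n \<Rightarrow> real^'n \<Rightarrow> nat \<Rightarrow> real" where
  "lars_const X y k \<equiv>
     equi_const X (corr_sign X y (lars_fit X y k)) (step_set X y (lars_fit X y k))"

lemma lars_terminates:
  fixes X :: "real^'m^'n"
  assumes inj: "inj ((*v) X)"
  shows "\<exists>K. lars_stops_at X y K"
proof -
  have "\<exists>k. max_corr X y (lars_fit X y k) = 0"
  proof (rule ccontr)
    assume "\<nexists>k. max_corr X y (lars_fit X y k) = 0"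
    then have pos: "0 < max_corr X y (lars_fit X y k)" for k
      using max_corr_nonneg by (metis order_le_less)
    have "lars_const X y (Suc k) < lars_const X y k" for k
      using lars_step.equi_const_next_less[OF lars_step.intro[OF inj pos], of k] pos[of "Suc k"]
      by simp
    then have "strict_mono (\<lambda>k. - lars_const X y k)" by (simp add: strict_mono_Suc_iff)
    then have "inj (\<lambda>k. - lars_const X y k)" by (rule strict_mono_imp_inj_on)
    then have "inj (lars_const X y)" by (simp add: inj_on_def)
    moreover have "range (lars_const X y)
        \<subseteq> (\<lambda>(s, B). equi_const X s B) ` ((UNIV \<rightarrow>\<^sub>E {- 1, 0, 1}) \<times> UNIV)"
    proof
      fix c assume "c \<in> range (lars_const X y)"
      then obtain k where c: "c = lars_const X y k" by blast
      have "corr_sign X y (lars_fit X y k) \<in> UNIV \<rightarrow>\<^sub>E {- 1, 0, 1}"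
        by (auto simp: corr_sign_def sgn_if split: if_splits)
      then show "c \<in> (\<lambda>(s, B). equi_const X s B) ` ((UNIV \<rightarrow>\<^sub>E {- 1, 0, 1}) \<times> UNIV)"
        unfolding c
        by (intro image_eqI[of _ _ "(corr_sign X y (lars_fit X y k), step_set X y (lars_fit X y k))"])
           simp_all
    qed
    then have "finite (range (lars_const X y))"
      by (rule finite_subset) (intro finite_imageI finite_cartesian_product finite_PiE; simp)
    ultimately show False by (simp add: finite_image_iff)
  qed
  then have "max_corr X y (lars_fit X y (LEAST k. max_corr X y (lars_fit X y k) = 0)) = 0"
    by (rule LeastI_ex)
  moreover have "0 < max_corr X y (lars_fit X y k)"
    if "k < (LEAST k. max_corr X y (lars_fit X y k) = 0)" for k
    using not_less_Least[OF that] max_corr_nonneg[of X y "lars_fit X y k"] by simp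
  ultimately show ?thesis unfolding lars_stops_at_def by blast
qed

lemma lars_fit_sum:
  "lars_fit X y k = (\<Sum>i<k. step_length X y (lars_fit X y i) *\<^sub>R step_dir X y (lars_fit X y i))"
  by (induction k) simp_all

lemma step_dir_in_range: "\<exists>b. X *v b = step_dir X y \<mu>"
  using equi_vec_comb[of X "corr_sign X y \<mu>" "step_set X y \<mu>"]
  unfolding step_dir_def signed_comb_as_product by metis

text \<open>
  The velocity \<open>v\<^sub>B = A\<^sub>B u\<^sub>B\<close> has speed \<open>A\<^sub>B\<close>, so Stagewise time \<open>\<delta> k\<close> for a step is its length divided
  by \<open>A\<^sub>B\<close>, and the time change \<open>h\<close> has slope \<open>A\<^sub>B\<close> on it. All paths are built from preimages \<open>b k\<close> of
  the directions, so that coefficients and fits are polygonal together.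
\<close>

lemma lars_path_is_stagewise_track:
  fixes X :: "real^'m^'n"
  assumes inj: "inj ((*v) X)"
  shows "\<exists>L \<alpha> T \<beta>. lars_path X y L \<alpha> \<and> reparametrizes T \<beta> L \<alpha> \<and> stagewise_track X y T \<beta>"
proof -
  obtain n where stop: "lars_stops_at X y n" using lars_terminates[OF inj] by blast
  define len where "len k = step_length X y (lars_fit X y k)" for k
  define u where "u k = step_dir X y (lars_fit X y k)" for k
  define \<kappa> where "\<kappa> k = lars_const X y k" for k
  define \<delta> where "\<delta> k = len k / \<kappa> k" for k
  have "\<exists>b. \<forall>k. X *v b k = u k"
    unfolding u_def by (rule choice) (use step_dir_in_range in blast)
  then obtain b where b: "\<And>k. X *v b k = u k" by blast
  have step: "lars_step X y (lars_fit X y k)" if "k < n" for k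
    using stop that inj by unfold_locales (auto simp: lars_stops_at_def)
  have len: "0 < len k" and \<kappa>: "0 < \<kappa> k" if "k < n" for k
    using lars_step.step_length_pos[OF step[OF that]] lars_step.K_pos[OF step[OF that]]
    by (auto simp: len_def \<kappa>_def)
  then have \<delta>: "0 < \<delta> k" if "k < n" for k using that by (simp add: \<delta>_def)
  have \<kappa>\<delta>: "\<kappa> k * \<delta> k = len k" if "k < n" for k using \<kappa>[OF that] by (simp add: \<delta>_def)
  have fit: "lars_fit X y k = X *v (\<Sum>i<k. len i *\<^sub>R b i)" for k
    unfolding lars_fit_sum[of X y k] len_def[symmetric] u_def[symmetric]
    by (simp add: linear_sum[OF matrix_vector_mul_linear] matrix_vector_mult_scaleR b)
  have time: "lars_time X y k = sum len {..<k}" for k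
    by (simp add: lars_time_def len_def)
  define \<alpha> where "\<alpha> = polygonal len b n"
  define \<beta> where "\<beta> = polygonal \<delta> (\<lambda>i. \<kappa> i *\<^sub>R b i) n"
  define h where "h = polygonal \<delta> \<kappa> n"
  define T where "T = sum \<delta> {..<n}"
  have "0 \<le> T" unfolding T_def using \<delta> by (intro sum_nonneg less_imp_le) auto
  have \<beta>_segment: "X *v \<beta> z = lars_fit X y k + (\<kappa> k * (z - sum \<delta> {..<k})) *\<^sub>R u k"
    if "k < n" "sum \<delta> {..<k} \<le> z" "z \<le> sum \<delta> {..<Suc k}" for k z
  proof -
    have "\<beta> z = (\<Sum>i<k. \<delta> i *\<^sub>R \<kappa> i *\<^sub>R b i) + (z - sum \<delta> {..<k}) *\<^sub>R \<kappa> k *\<^sub>R b k"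
      unfolding \<beta>_def using \<delta> that by (intro polygonal_segment)
    also have "(\<Sum>i<k. \<delta> i *\<^sub>R \<kappa> i *\<^sub>R b i) = (\<Sum>i<k. len i *\<^sub>R b i)"
      using that(1) by (intro sum.cong) (auto simp: \<kappa>\<delta>[symmetric] mult.commute)
    finally show ?thesis
      by (simp add: matrix_vector_right_distrib matrix_vector_mult_scaleR fit b mult.commute)
  qed
  have \<beta>_end: "X *v \<beta> T = lars_fit X y n"
  proof -
    have "\<beta> T = (\<Sum>i<n. \<delta> i *\<^sub>R \<kappa> i *\<^sub>R b i)"
      unfolding \<beta>_def T_def using \<delta> by (intro polygonal_end)
    also have "\<dots> = (\<Sum>i<n. len i *\<^sub>R b i)"
      by (intro sum.cong) (auto simp: \<kappa>\<delta>[symmetric] mult.commute)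
    finally show ?thesis by (simp add: fit)
  qed
  have "lars_path X y (sum len {..<n}) \<alpha>"
    unfolding lars_path_def
  proof (intro exI conjI allI impI ballI)
    show "X *v \<alpha> 0 = 0" using polygonal_start[of n len b] len by (simp add: \<alpha>_def)
    fix k \<gamma> assume k: "k < n" and \<gamma>: "\<gamma> \<in> {0..step_length X y (lars_fit X y k)}"
    have "\<alpha> (lars_time X y k + \<gamma>) = (\<Sum>i<k. len i *\<^sub>R b i) + \<gamma> *\<^sub>R b k"
      using polygonal_segment[of n len k "sum len {..<k} + \<gamma>" b] len k \<gamma>
      by (simp add: \<alpha>_def time len_def[symmetric])
    then show "X *v \<alpha> (lars_time X y k + \<gamma>)
        = lars_fit X y k + \<gamma> *\<^sub>R step_dir X y (lars_fit X y k)"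
      by (simp add: matrix_vector_right_distrib matrix_vector_mult_scaleR fit[symmetric] b u_def)
  qed (use stop time in auto)
  moreover have "reparametrizes T \<beta> (sum len {..<n}) \<alpha>"
    unfolding reparametrizes_def
  proof (intro exI[of _ h] conjI ballI)
    show "continuous_on {0..T} h" unfolding h_def by (rule continuous_on_polygonal)
    show "strict_mono_on {0..T} h"
      unfolding h_def T_def using \<delta> \<kappa> by (intro strict_mono_polygonal)
    have "h ` {0..T} = {0..\<Sum>i<n. \<kappa> i * \<delta> i}"
      unfolding h_def T_def using \<delta> \<kappa> by (intro polygonal_image)
    then show "h ` {0..T} = {0..sum len {..<n}}" using \<kappa>\<delta> by simp
    fix z assume "z \<in> {0..T}"
    then have "\<beta> z = polygonal (\<lambda>i. \<kappa> i * \<delta> i) b n (h z)"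
      unfolding \<beta>_def h_def T_def using \<delta> \<kappa> by (intro polygonal_reparametrization)
    also have "\<dots> = \<alpha> (h z)"
      unfolding \<alpha>_def polygonal_def using \<kappa>\<delta> by (intro sum.cong refl) simp
    finally show "\<beta> z = \<alpha> (h z)" .
  qed
  moreover have "stagewise_track X y T \<beta>"
    unfolding stagewise_track_def
  proof (intro conjI ballI)
    show "0 \<le> T" by fact
    show "continuous_on {0..T} \<beta>" unfolding \<beta>_def by (rule continuous_on_polygonal)
    show "\<beta> 0 = 0" unfolding \<beta>_def using \<delta> by (rule polygonal_start)
    show "is_ols X y (\<beta> T)"
      using stop by (simp add: max_corr_eq_0_iff_ols[symmetric] \<beta>_end lars_stops_at_def)
    fix z assume "z \<in> {0..<T}"
    then obtain k where k: "k < n" "sum \<delta> {..<k} \<le> z" "z < sum \<delta> {..<Suc k}"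
      using knot_interval[of z \<delta> n] by (auto simp: T_def)
    define \<gamma> where "\<gamma> = \<kappa> k * (z - sum \<delta> {..<k})"
    have \<gamma>0: "0 \<le> \<gamma>" using k(2) \<kappa>[OF k(1)] by (simp add: \<gamma>_def)
    have "\<kappa> k * (z - sum \<delta> {..<k}) < \<kappa> k * \<delta> k"
      using k(3) \<kappa>[OF k(1)] by (intro mult_strict_left_mono) auto
    then have \<gamma>1: "\<gamma> < step_length X y (lars_fit X y k)"
      unfolding \<gamma>_def \<kappa>\<delta>[OF k(1)] len_def .
    have z: "X *v \<beta> z = lars_fit X y k + \<gamma> *\<^sub>R step_dir X y (lars_fit X y k)"
      using \<beta>_segment[of k z] k by (simp add: \<gamma>_def u_def)
    show "0 < max_corr X y (X *v \<beta> z)"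
      unfolding z by (rule lars_step.max_corr_moved_pos[OF step[OF k(1)] \<gamma>0 \<gamma>1])
    have der: "(\<beta> has_vector_derivative \<kappa> k *\<^sub>R b k) (at_right z)"
      unfolding \<beta>_def using \<delta> k by (intro polygonal_right_derivative)
    then show "\<exists>d. (\<beta> has_vector_derivative d) (at_right z)" by blast
    have "((\<lambda>t. X *v \<beta> t) has_vector_derivative X *v (\<kappa> k *\<^sub>R b k)) (at_right z)"
      by (rule bounded_linear.has_vector_derivative[OF matrix_vector_mul_bounded_linear der])
    moreover have "stagewise_velocity X y (X *v \<beta> z) (X *v (\<kappa> k *\<^sub>R b k))"
      using lars_step.stagewise_velocity_moved[OF step[OF k(1)] \<gamma>0 \<gamma>1]
      by (simp add: z matrix_vector_mult_scaleR b \<kappa>_def u_def)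
    ultimately show "\<exists>v. ((\<lambda>t. X *v \<beta> t) has_vector_derivative v) (at_right z) \<and>
        stagewise_velocity X y (X *v \<beta> z) v" by blast
  qed
  ultimately show ?thesis by blast
qed

theorem theorem2:
  fixes X :: "real^'m^'n" and y :: "real^'n"
  assumes "\<And>b :: 'm \<Rightarrow> real. (\<Sum>j\<in>UNIV. b j *\<^sub>R column j X) = 0 \<Longrightarrow> (\<forall>j. b j = 0)"
    and "(\<Sum>i\<in>UNIV. y $ i) = 0"
    and "\<And>j. (\<Sum>i\<in>UNIV. X $ i $ j) = 0"
    and "\<And>j. (\<Sum>i\<in>UNIV. (X $ i $ j)\<^sup>2) = 1"
  shows "\<exists>L \<alpha> T \<beta>. lars_path X y L \<alpha> \<and> reparametrizes T \<beta> L \<alpha> \<and> stagewise_track X y T \<beta> \<and>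
           (\<forall>T' \<beta>'. stagewise_track X y T' \<beta>' \<longrightarrow> T' = T \<and> (\<forall>z\<in>{0..T}. \<beta>' z = \<beta> z))"
proof -
  have inj: "inj ((*v) X)" by (rule inj_design) (rule assms(1))
  obtain L \<alpha> T \<beta> where
    "lars_path X y L \<alpha>" "reparametrizes T \<beta> L \<alpha>" and track: "stagewise_track X y T \<beta>"
    using lars_path_is_stagewise_track[OF inj] by blast
  with stagewise_track_unique[OF inj track] show ?thesis by blast
qed

end
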